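(* Let $n\ge 3$ and let $\Psi:\mathcal{S}^n\to\mathcal{S}^n$ be a nontrivial radial Blaschke Minkowski homomorphism. If $L_1,\ldots,L_{n-1}\in\mathcal{S}^n$, then $$V(\Psi(L_1,\ldots,L_{n-1}))^2\le V(\Psi(L_1,L_1,L_3,\ldots,L_{n-1}))\,V(\Psi(L_2,L_2,L_3,\ldots,L_{n-1})),$$ with equality if and only if $L_1$ and $L_2$ are dilates.
   Context: $\mathcal{S}^n$ is the space of star bodies in $\mathbb{R}^n$, i.e. compact sets $L$, starshaped with respect to the origin, whose radial function $\rho(L,u)=\max\{\lambda\ge 0:\lambda u\in L\}$, $u\in S^{n-1}$, is continuous. $\mathcal{S}^n$ is endowed with the Hausdorff topology. $V$ is volume. $K$ and $L$ are dilates if $K=\lambda L$ for some $\lambda>0$. The radial Minkowski sum is defined by $\rho(K\,\tilde{+}\,L,\cdot)=\rho(K,\cdot)+\rho(L,\cdot)$, and the radial Blaschke sum by $\rho^{n-1}(K\,\tilde{\#}\,L,\cdot)=\rho^{n-1}(K,\cdot)+\rho^{n-1}(L,\cdot)$. A radial Blaschke Minkowski homomorphism is a map $\Psi:\mathcal{S}^n\to\mathcal{S}^n$ such that (a) $\Psi$ is continuous; (b) $\Psi(K\,\tilde{\#}\,L)=\Psi K\,\tilde{+}\,\Psi L$ for all $K,L\in\mathcal{S}^n$; (c) $\Psi$ intertwines rotations, i.e. $\Psi(\vartheta L)=\vartheta\Psi L$ for all $L\in\mathcal{S}^n$ and all $\vartheta\in SO(n)$. The trivial one is the operator that maps every star body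 to the origin. Mixed operator: for $L_1,\ldots,L_{n-1}\in\mathcal{S}^n$, $\Psi(L_1,\ldots,L_{n-1}):=\Psi(L)$ where $L\in\mathcal{S}^n$ is the star body with $\rho^{n-1}(L,\cdot)=\rho(L_1,\cdot)\cdots\rho(L_{n-1},\cdot)$. In particular $\Psi(L,\ldots,L)=\Psi L$.
   Formalization: Equality implies that L_1 and L_2 are dilates is claimed only when L_1, L_2 differ from {0} and L_3,…,L_{n-1} have positive radial functions; without a condition it fails (L_1={0}, L_2 a ball). The inequality and its equality for dilates hold for all star bodies. *)

theory Defs
  imports "HOL-Analysis.Analysis"
begin

text \<open>For compact \<open>L\<close> containing the origin the supremum is attained, see
  \<open>radial_attained\<close> below, so it is the maximum. Only unit vectors \<open>u\<close> matter.\<close>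

definition radial :: "(real ^ 'n) set \<Rightarrow> real ^ 'n \<Rightarrow> real" where
  "radial L u = Sup {l. 0 \<le> l \<and> l *\<^sub>R u \<in> L}"

text \<open>The radial function may vanish; in particular the set consisting of the origin alone
  is a star body.\<close>

definition star_bodies :: "(real ^ 'n) set set" where
  "star_bodies = {L. compact L \<and> 0 \<in> L \<and> (\<forall>x\<in>L. closed_segment 0 x \<subseteq> L) \<and>
     continuous_on (sphere 0 1) (radial L)}"

lemma radial_attained:
  fixes L :: "(real ^ 'n) set"
  assumes L: "compact L" "0 \<in> L" and u: "u \<in> sphere 0 1"
  shows "0 \<le> radial L u" "radial L u *\<^sub>R u \<in> L"
    and "\<And>l. 0 \<le> l \<Longrightarrow> l *\<^sub>R u \<in> L \<Longrightarrow> l \<le> radial L u"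
proof -
  let ?S = "{l. 0 \<le> l \<and> l *\<^sub>R u \<in> L}"
  have nu: "norm u = 1" using u by simp
  obtain B where B: "\<And>x. x \<in> L \<Longrightarrow> norm x \<le> B"
    using compact_imp_bounded[OF L(1)] by (auto simp: bounded_iff)
  have ne: "?S \<noteq> {}" using L(2) by (auto intro: exI[of _ 0])
  have bdd: "bdd_above ?S"
    using B nu by (intro bdd_aboveI[of _ B]) force
  have "?S = {0..} \<inter> (\<lambda>l. l *\<^sub>R u) -` L" by auto
  moreover have "closed ((\<lambda>l. l *\<^sub>R u) -` L)"
    by (intro continuous_closed_vimage compact_imp_closed L(1)) (intro continuous_intros)
  ultimately have "closed ?S" by auto
  from closed_contains_Sup[OF ne bdd this]
  show "0 \<le> radial L u" "radial L u *\<^sub>R u \<in> L"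
    by (auto simp: radial_def)
  show "l \<le> radial L u" if "0 \<le> l" "l *\<^sub>R u \<in> L" for l
    unfolding radial_def using that bdd by (intro cSup_upper) auto
qed

lemma star_body_eq:
  fixes L :: "(real ^ 'n) set"
  assumes L: "L \<in> star_bodies"
  shows "L = {l *\<^sub>R u |l u. u \<in> sphere 0 1 \<and> 0 \<le> l \<and> l \<le> radial L u}"
proof (intro equalityI subsetI)
  have c: "compact L" "0 \<in> L" and s: "\<And>x. x \<in> L \<Longrightarrow> closed_segment 0 x \<subseteq> L"
    using L by (auto simp: star_bodies_def)
  fix x assume x: "x \<in> L"
  show "x \<in> {l *\<^sub>R u |l u. u \<in> sphere 0 1 \<and> 0 \<le> l \<and> l \<le> radial L u}"
  proof (cases "x = 0")
    case True
    have "axis undefined 1 \<in> sphere (0 :: real ^ 'n) 1" by (simp add: norm_axis_1)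
    with radial_attained(1)[OF c this] True show ?thesis by force
  next
    case False
    then have u: "x /\<^sub>R norm x \<in> sphere 0 1" and e: "norm x *\<^sub>R (x /\<^sub>R norm x) = x" by auto
    have "norm x \<le> radial L (x /\<^sub>R norm x)"
      using radial_attained(3)[OF c u, of "norm x"] x e by simp
    with u e[symmetric] norm_ge_zero[of x] show ?thesis by blast
  qed
next
  have c: "compact L" "0 \<in> L" and s: "\<And>x. x \<in> L \<Longrightarrow> closed_segment 0 x \<subseteq> L"
    using L by (auto simp: star_bodies_def)
  fix x assume "x \<in> {l *\<^sub>R u |l u. u \<in> sphere 0 1 \<and> 0 \<le> l \<and> l \<le> radial L u}"
  then obtain l u where x: "x = l *\<^sub>R u" and u: "u \<in> sphere 0 1" and l: "0 \<le> l" "l \<le> radial L u"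
    by blast
  show "x \<in> L"
  proof (cases "radial L u = 0")
    case True
    with l x c show ?thesis by auto
  next
    case False
    with l have "0 < radial L u" by linarith
    then have "x = (l / radial L u) *\<^sub>R (radial L u *\<^sub>R u)" using x by simp
    moreover have "0 \<le> l / radial L u" "l / radial L u \<le> 1" using l \<open>0 < radial L u\<close> by auto
    ultimately have "x \<in> closed_segment 0 (radial L u *\<^sub>R u)"
      unfolding in_segment by (intro exI[of _ "l / radial L u"]) simp
    then show ?thesis using s[OF radial_attained(2)[OF c u]] by auto
  qed
qed

text \<open>A star body is determined by its radial function, and every nonnegative continuous
  function on the sphere occurs. Hence the definite descriptions below are proper (those involving
  the power \<open>n - 1\<close> for \<open>n \<ge> 2\<close>).\<close>

lemma ex1_star_body_radial:
  fixes f :: "real ^ 'n \<Rightarrow> real"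
  assumes f: "continuous_on (sphere 0 1) f" "\<And>u. u \<in> sphere 0 1 \<Longrightarrow> 0 \<le> f u"
  shows "\<exists>!K. K \<in> star_bodies \<and> (\<forall>u\<in>sphere 0 1. radial K u = f u)"
proof (rule ex_ex1I)
  let ?g = "\<lambda>p :: real \<times> (real ^ 'n). (fst p * f (snd p)) *\<^sub>R snd p"
  define K where "K = ?g ` ({0..1} \<times> sphere 0 1)"
  have comp: "compact K" unfolding K_def
    by (intro compact_continuous_image compact_Times continuous_intros
        continuous_on_compose2[OF f(1)]) auto
  have "axis undefined 1 \<in> sphere (0 :: real ^ 'n) 1" by (simp add: norm_axis_1)
  then have "(0, axis undefined 1) \<in> {0..1 :: real} \<times> sphere (0 :: real ^ 'n) 1" by simp
  from imageI[OF this, of ?g] have zero: "0 \<in> K" unfolding K_def by simp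
  have star: "closed_segment 0 x \<subseteq> K" if "x \<in> K" for x
  proof
    from that obtain t u where t: "0 \<le> t" "t \<le> 1" and u: "u \<in> sphere 0 1"
      and x: "x = (t * f u) *\<^sub>R u" unfolding K_def by auto
    fix y assume "y \<in> closed_segment 0 x"
    then obtain s where s: "0 \<le> s" "s \<le> 1" "y = s *\<^sub>R x" by (auto simp: in_segment)
    have "(s * t, u) \<in> {0..1} \<times> sphere 0 1" using s t u by (auto simp: mult_le_one)
    from imageI[OF this, of ?g] show "y \<in> K" unfolding K_def using s x by (simp add: mult.assoc)
  qed
  have rad: "radial K u = f u" if u: "u \<in> sphere 0 1" for u
  proof (rule antisym)
    have "(1, u) \<in> {0..1 :: real} \<times> sphere 0 1" using u by simp
    from imageI[OF this, of ?g] have "f u *\<^sub>R u \<in> K" unfolding K_def by simp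
    then show "f u \<le> radial K u" using radial_attained(3)[OF comp zero u] f(2)[OF u] by blast
    from radial_attained(2)[OF comp zero u] obtain t v where t: "0 \<le> t" "t \<le> 1"
      and v: "v \<in> sphere 0 1" and e: "radial K u *\<^sub>R u = (t * f v) *\<^sub>R v" unfolding K_def by auto
    have r: "0 \<le> radial K u" by (rule radial_attained(1)[OF comp zero u])
    have "norm (radial K u *\<^sub>R u) = norm ((t * f v) *\<^sub>R v)" using e by simp
    then have n: "radial K u = t * f v" using u v r t f(2)[OF v] by (simp add: abs_mult)
    show "radial K u \<le> f u"
    proof (cases "radial K u = 0")
      case True then show ?thesis using f(2)[OF u] by simp
    next
      case False
      then have "u = v" using e n by simp
      then show ?thesis using n t f(2)[OF u] by (simp add: mult_left_le_one_le)
    qed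
  qed
  have "continuous_on (sphere 0 1) (radial K)"
    by (rule iffD2[OF continuous_on_cong[OF refl rad] f(1)])
  with comp zero star have "K \<in> star_bodies"
    by (auto simp: star_bodies_def)
  with rad show "\<exists>K. K \<in> star_bodies \<and> (\<forall>u\<in>sphere 0 1. radial K u = f u)"
    by blast
next
  fix K M :: "(real ^ 'n) set"
  assume K: "K \<in> star_bodies \<and> (\<forall>u\<in>sphere 0 1. radial K u = f u)"
    and M: "M \<in> star_bodies \<and> (\<forall>u\<in>sphere 0 1. radial M u = f u)"
  have "K = {l *\<^sub>R u |l u. u \<in> sphere 0 1 \<and> 0 \<le> l \<and> l \<le> radial K u}"
    using K by (intro star_body_eq) simp
  also have "\<dots> = {l *\<^sub>R u |l u. u \<in> sphere 0 1 \<and> 0 \<le> l \<and> l \<le> radial M u}"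
  proof -
    have "u \<in> sphere 0 1 \<Longrightarrow> radial K u = radial M u" for u using K M by simp
    then show ?thesis by (intro Collect_cong ex_cong1 conj_cong refl) simp_all
  qed
  also have "\<dots> = M"
    using M by (intro star_body_eq[symmetric]) simp
  finally show "K = M" .
qed

lemma ex1_star_body_radial_power:
  fixes f :: "real ^ 'n \<Rightarrow> real"
  assumes f: "continuous_on (sphere 0 1) f" "\<And>u. u \<in> sphere 0 1 \<Longrightarrow> 0 \<le> f u"
    and m: "0 < m"
  shows "\<exists>!K. K \<in> star_bodies \<and> (\<forall>u\<in>sphere 0 1. radial K u ^ m = f u)"
proof -
  have "(radial K u ^ m = f u) = (radial K u = root m (f u))"
    if "K \<in> star_bodies" "u \<in> sphere 0 1" for K u
  proof -
    have "0 \<le> radial K u" using that by (intro radial_attained(1)) (auto simp: star_bodies_def)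
    then show ?thesis using f(2)[OF that(2)] m
      by (metis real_root_power_cancel real_root_pow_pos2)
  qed
  then have eq: "(K \<in> star_bodies \<and> (\<forall>u\<in>sphere 0 1. radial K u ^ m = f u)) =
      (K \<in> star_bodies \<and> (\<forall>u\<in>sphere 0 1. radial K u = root m (f u)))" for K
    by blast
  show ?thesis unfolding eq
    using f m by (intro ex1_star_body_radial continuous_intros) auto
qed

definition dilates :: "(real ^ 'n) set \<Rightarrow> (real ^ 'n) set \<Rightarrow> bool" where
  "dilates K L \<longleftrightarrow> (\<exists>l>0. K = (\<lambda>x. l *\<^sub>R x) ` L)"

definition radial_minkowski_sum :: "(real ^ 'n) set \<Rightarrow> (real ^ 'n) set \<Rightarrow> (real ^ 'n) set" where
  "radial_minkowski_sum K L = (THE M. M \<in> star_bodies \<and>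
     (\<forall>u\<in>sphere 0 1. radial M u = radial K u + radial L u))"

definition radial_blaschke_sum :: "(real ^ 'n) set \<Rightarrow> (real ^ 'n) set \<Rightarrow> (real ^ 'n) set" where
  "radial_blaschke_sum K L = (THE M. M \<in> star_bodies \<and>
     (\<forall>u\<in>sphere 0 1. radial M u ^ (CARD('n) - 1) =
        radial K u ^ (CARD('n) - 1) + radial L u ^ (CARD('n) - 1)))"

text \<open>Intended for nonempty compact sets, where both suprema are finite.\<close>

definition hausdorff_dist :: "(real ^ 'n) set \<Rightarrow> (real ^ 'n) set \<Rightarrow> real" where
  "hausdorff_dist K L = max (SUP x\<in>K. infdist x L) (SUP y\<in>L. infdist y K)"

definition hausdorff_continuous :: "((real ^ 'n) set \<Rightarrow> (real ^ 'n) set) \<Rightarrow> bool" where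
  "hausdorff_continuous \<Psi> \<longleftrightarrow>
     (\<forall>K\<in>star_bodies. \<forall>e>0. \<exists>d>0. \<forall>L\<in>star_bodies.
        hausdorff_dist K L < d \<longrightarrow> hausdorff_dist (\<Psi> K) (\<Psi> L) < e)"

definition radial_blaschke_minkowski_hom :: "((real ^ 'n) set \<Rightarrow> (real ^ 'n) set) \<Rightarrow> bool" where
  "radial_blaschke_minkowski_hom \<Psi> \<longleftrightarrow>
     \<Psi> \<in> star_bodies \<rightarrow> star_bodies \<and>
     hausdorff_continuous \<Psi> \<and>
     (\<forall>K\<in>star_bodies. \<forall>L\<in>star_bodies.
        \<Psi> (radial_blaschke_sum K L) = radial_minkowski_sum (\<Psi> K) (\<Psi> L)) \<and>
     (\<forall>L\<in>star_bodies. \<forall>A. rotation_matrix A \<longrightarrow> \<Psi> ((*v) A ` L) = (*v) A ` \<Psi> L)"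

definition trivial_hom :: "((real ^ 'n) set \<Rightarrow> (real ^ 'n) set) \<Rightarrow> bool" where
  "trivial_hom \<Psi> \<longleftrightarrow> (\<forall>L\<in>star_bodies. \<Psi> L = {0})"

text \<open>A tuple of \<open>n - 1\<close> star bodies is a function on \<open>nat\<close> of which only the
  values at \<open>1, \<dots>, n - 1\<close> are used.\<close>

definition mixed_body :: "(nat \<Rightarrow> (real ^ 'n) set) \<Rightarrow> (real ^ 'n) set" where
  "mixed_body L = (THE K. K \<in> star_bodies \<and>
     (\<forall>u\<in>sphere 0 1. radial K u ^ (CARD('n) - 1) = (\<Prod>i=1..CARD('n) - 1. radial (L i) u)))"

definition mixed ::
    "((real ^ 'n) set \<Rightarrow> (real ^ 'n) set) \<Rightarrow> (nat \<Rightarrow> (real ^ 'n) set) \<Rightarrow> (real ^ 'n) set" where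
  "mixed \<Psi> L = \<Psi> (mixed_body L)"

end

(*
  Write T f for the radial function of \<Psi> K, where radial K ^ (n - 1) = f. Then T is additive on
  nonnegative continuous functions on the sphere, hence monotone, hence positively homogeneous.
  Expanding 0 \<le> T ((s r1 - r2)^2 h) gives the pointwise
  Cauchy-Schwarz inequality T (r1 r2 h)^2 \<le> T (r1^2 h) T (r2^2 h). The volume is, up to a constant
  factor, the integral over the sphere of the n-th power of the radial function, and a second
  application of Cauchy-Schwarz gives the inequality. Equality forces T (r1 r2 h) = k T (r1^2 h) and
  T (r2^2 h) = k^2 T (r1^2 h) for some k > 0, so T ((k r1 - r2)^2 h) = 0. Since T commutes with
  rotations and is not 0, it annihilates no nonzero function of the cone, hence r2 = k r1.
*)
theory Submission
  imports Defs
begin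

text \<open>\<open>T\<close> lives on a cone, not on a vector space: it has no value at
  \<open>k * r1 - r2\<close>, only at nonnegative functions such as
  \<open>(k * r1 - r2)^2 * h\<close>. Hence the quadratic inequality is available only for scalars
  \<open>s \<ge> 0\<close>. This is enough because the mixed term \<open>T (r1 r2 h)\<close> is
  nonnegative, which puts the minimiser of the quadratic on that half-line.

  In the equality case, pointwise equality alone would leave a factor that varies with the
  direction. The single constant \<open>k\<close> comes from the integrated inequality: one
  quadratic polynomial, at its minimiser, is the integral of a nonnegative continuous function, and
  that function vanishes identically. So one fixed function is annihilated by \<open>T\<close> on
  the whole sphere.

  That \<open>T\<close> annihilates no nonzero function is a domination argument. If
  \<open>T\<close> kills a function then it kills its rotates; finitely many of them add up to a
  strictly positive function, and a multiple of this sum dominates any given element of the cone, so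
  monotonicity would make \<open>T\<close> vanish.

  Integrals over the sphere are taken over the unit ball after radial extension, so the volume
  formula compares two Lebesgue integrals.\<close>

section \<open>Volume in polar coordinates\<close>

text \<open>Since \<open>f\<close> is constant along open rays, dilation by the \<open>n\<close>-th
  root of \<open>s\<close> maps one set onto the other and multiplies volume by \<open>s\<close>.
  The predicate \<open>P\<close> is left arbitrary because two regions are scaled later: the one
  below the graph of \<open>f\<close>, and a ball cut with a superlevel set of
  \<open>f\<close>.\<close>

lemma emeasure_cone_scale:
  fixes f :: "real ^ 'n \<Rightarrow> real"
  assumes hom: "\<And>c x. 0 < c \<Longrightarrow> f (c *\<^sub>R x) = f x" and s: "0 < s"
    and meas: "{x. P (norm x ^ CARD('n)) (f x)} \<in> sets borel"
      "{x. P (norm x ^ CARD('n) / s) (f x)} \<in> sets borel"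
  shows "emeasure lborel {x. P (norm x ^ CARD('n) / s) (f x)} =
    ennreal s * emeasure lborel {x. P (norm x ^ CARD('n)) (f x)}"
proof -
  define c where "c = root CARD('n) s"
  have c: "0 < c" "c ^ CARD('n) = s" using s by (simp_all add: c_def)
  have eq: "{x. P (norm x ^ CARD('n) / s) (f x)} =
      (\<lambda>x. c *\<^sub>R x + 0) ` {x. P (norm x ^ CARD('n)) (f x)}" (is "?A = ?B")
  proof (intro equalityI subsetI)
    fix x assume "x \<in> ?A"
    moreover have "norm x ^ CARD('n) / s = norm (inverse c *\<^sub>R x) ^ CARD('n)"
      using c by (simp add: power_mult_distrib power_inverse field_simps)
    moreover have "f x = f (inverse c *\<^sub>R x)" using hom[of "inverse c" x] c by simp
    ultimately have "inverse c *\<^sub>R x \<in> {x. P (norm x ^ CARD('n)) (f x)}" by simp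
    moreover have "x = c *\<^sub>R (inverse c *\<^sub>R x) + 0" using c by simp
    ultimately show "x \<in> ?B" by blast
  next
    fix x assume "x \<in> ?B"
    then obtain y where y: "x = c *\<^sub>R y" "P (norm y ^ CARD('n)) (f y)" by auto
    have "norm x ^ CARD('n) / s = norm y ^ CARD('n)"
      using c s y(1) by (simp add: power_mult_distrib)
    with y hom[OF c(1), of y] show "x \<in> ?A" by simp
  qed
  have "emeasure lebesgue ?A = ennreal \<bar>c\<bar> ^ DIM(real ^ 'n) *
      emeasure lebesgue {x. P (norm x ^ CARD('n)) (f x)}"
    unfolding eq using emeasure_lebesgue_affine[of c 0 "{x. P (norm x ^ CARD('n)) (f x)}"] 
    by (simp add: ennreal_power)
  moreover have "ennreal \<bar>c\<bar> ^ DIM(real ^ 'n) = ennreal s" using c by (simp add: ennreal_power)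
  ultimately show ?thesis using meas by simp
qed

text \<open>The substitution that replaces \<open>s\<close> by \<open>f * s\<close> breaks down at
  \<open>f = 0\<close>; there \<open>0 < z\<close> makes both sets empty.\<close>

lemma nn_integral_haar_segment:
  assumes f: "0 \<le> f" and z: "0 < z"
  shows "(\<integral>\<^sup>+s. indicator {s. 0 < s \<and> s \<le> 1 \<and> z \<le> s * f} s * ennreal (1 / s) \<partial>lborel) =
    (\<integral>\<^sup>+s. indicator {s. 0 < s \<and> z \<le> s \<and> s \<le> f} s * ennreal (1 / s) \<partial>lborel)"
proof (cases "f = 0")
  case True
  then have "{s. 0 < s \<and> s \<le> 1 \<and> z \<le> s * f} = {}" "{s. 0 < s \<and> z \<le> s \<and> s \<le> f} = {}"
    using z by auto
  then show ?thesis by simp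
next
  case False
  with f have f: "0 < f" by simp
  have "(\<integral>\<^sup>+s. indicator {s. 0 < s \<and> z \<le> s \<and> s \<le> f} s * ennreal (1 / s) \<partial>lborel) =
    ennreal \<bar>f\<bar> * (\<integral>\<^sup>+s. indicator {s. 0 < s \<and> z \<le> s \<and> s \<le> f} (0 + f * s) *
      ennreal (1 / (0 + f * s)) \<partial>lborel)"
    using f by (intro nn_integral_real_affine) auto
  also have "\<dots> = (\<integral>\<^sup>+s. ennreal \<bar>f\<bar> * (indicator {s. 0 < s \<and> z \<le> s \<and> s \<le> f} (0 + f * s) *
      ennreal (1 / (0 + f * s))) \<partial>lborel)"
    by (intro nn_integral_cmult[symmetric]) measurable
  also have "\<dots> = (\<integral>\<^sup>+s. indicator {s. 0 < s \<and> s \<le> 1 \<and> z \<le> s * f} s * ennreal (1 / s) \<partial>lborel)"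
    using f
    by (intro nn_integral_cong)
       (auto simp: indicator_def zero_less_mult_iff mult.commute ennreal_mult'[symmetric])
  finally show ?thesis ..
qed

text \<open>Both sides are evaluated by Fubini as integrals over pairs \<open>(x, s)\<close> with respect to
  \<open>dx ds / s\<close>; for fixed \<open>x\<close> they differ by a dilation in \<open>s\<close>, under which \<open>ds / s\<close> is invariant.\<close>

lemma emeasure_cone_body:
  fixes f :: "real ^ 'n \<Rightarrow> real"
  assumes hom: "\<And>c x. 0 < c \<Longrightarrow> f (c *\<^sub>R x) = f x" and nonneg: "\<And>x. 0 \<le> f x"
    and f[measurable]: "f \<in> borel_measurable borel"
  shows "emeasure lborel {x. norm x ^ CARD('n) \<le> f x} =
    (\<integral>\<^sup>+x. indicator (cball 0 1) x * ennreal (f x) \<partial>lborel)"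
proof -
  let ?n = "CARD('n)"
  let ?V = "emeasure lborel {x. norm x ^ ?n \<le> f x}"
  have bor: "{x. norm x ^ ?n / s \<le> f x} \<in> sets borel"
    "{x. norm x ^ ?n \<le> s * f x} \<in> sets borel"
    "{x. norm x ^ ?n \<le> f x} \<in> sets borel"
    "{x. norm x ^ ?n \<le> s \<and> s \<le> f x} \<in> sets borel"
    "{x. norm x ^ ?n / s \<le> 1 \<and> s \<le> f x} \<in> sets borel"
    "{x. norm x ^ ?n \<le> 1 \<and> s \<le> f x} \<in> sets borel" for s
    by measurable
  have one: "(\<integral>\<^sup>+s. indicator {0<..1 :: real} s \<partial>lborel) = (1 :: ennreal)"
    by (subst nn_integral_indicator) auto
  \<comment> \<open>The interval \<open>(0, 1]\<close> has length 1. For \<open>s\<close> in it, the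
    set with \<open>f\<close> replaced by \<open>s * f\<close> has volume \<open>s * ?V\<close>, and
    the factor \<open>s\<close> cancels against the density \<open>1 / s\<close>.\<close>
  have "?V = (\<integral>\<^sup>+s. indicator {0<..1::real} s * ?V \<partial>lborel)"
    by (subst nn_integral_multc) (simp_all add: one)
  also have "\<dots> = (\<integral>\<^sup>+s. (\<integral>\<^sup>+x. indicator {(x, s). 0 < s \<and> s \<le> 1 \<and> norm x ^ ?n \<le> s * f x} (x, s)
      * ennreal (1 / s) \<partial>lborel) \<partial>lborel)"
  proof (rule nn_integral_cong)
    fix s :: real
    show "indicator {0<..1::real} s * ?V = (\<integral>\<^sup>+x. indicator {(x, s). 0 < s \<and> s \<le> 1 \<and> norm x ^ ?n \<le> s * f x} (x, s)
      * ennreal (1 / s) \<partial>lborel)"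
    proof (cases "0 < s \<and> s \<le> 1")
      case True
      then have s: "0 < s" by simp
      have "(\<integral>\<^sup>+x. indicator {(x, s). 0 < s \<and> s \<le> 1 \<and> norm x ^ ?n \<le> s * f x} (x, s)
          * ennreal (1 / s) \<partial>lborel) = (\<integral>\<^sup>+x. indicator {x. norm x ^ ?n / s \<le> f x} x * ennreal (1 / s) \<partial>lborel)"
        using True by (intro nn_integral_cong) (auto simp: indicator_def field_simps)
      also have "\<dots> = emeasure lborel {x. norm x ^ ?n / s \<le> f x} * ennreal (1 / s)"
        using bor by (subst nn_integral_multc) simp_all
      also have "\<dots> = (ennreal s * ?V) * ennreal (1 / s)"
        using emeasure_cone_scale[where P = "\<lambda>a b. a \<le> b" and f = f, OF hom s] bor by simp
      also have "\<dots> = (ennreal s * ennreal (1 / s)) * ?V" by (simp add: ac_simps)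
      also have "ennreal s * ennreal (1 / s) = 1" using s by (simp flip: ennreal_mult')
      finally show ?thesis using True by simp
    next
      case False
      then show ?thesis by auto
    qed
  qed
  also have "\<dots> = (\<integral>\<^sup>+x. (\<integral>\<^sup>+s. indicator {(x, s). 0 < s \<and> s \<le> 1 \<and> norm x ^ ?n \<le> s * f x} (x, s)
      * ennreal (1 / s) \<partial>lborel) \<partial>lborel)"
    by (intro lborel_pair.Fubini') measurable
  also have "\<dots> = (\<integral>\<^sup>+x. (\<integral>\<^sup>+s. indicator {(x, s). 0 < s \<and> norm x ^ ?n \<le> s \<and> s \<le> f x} (x, s)
      * ennreal (1 / s) \<partial>lborel) \<partial>lborel)"
  \<comment> \<open>The origin is discarded as a null set, because the exchange in \<open>s\<close>
    requires \<open>0 < norm x ^ n\<close>.\<close>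
  proof (rule nn_integral_cong_AE, rule AE_mp[OF AE_lborel_singleton[of 0]], intro AE_I2 impI)
    fix x :: "real ^ 'n" assume "x \<noteq> 0"
    then have "0 < norm x ^ ?n" by simp
    from nn_integral_haar_segment[OF nonneg this, of x]
    show "(\<integral>\<^sup>+s. indicator {(x, s). 0 < s \<and> s \<le> 1 \<and> norm x ^ ?n \<le> s * f x} (x, s) * ennreal (1 / s) \<partial>lborel)
      = (\<integral>\<^sup>+s. indicator {(x, s). 0 < s \<and> norm x ^ ?n \<le> s \<and> s \<le> f x} (x, s) * ennreal (1 / s) \<partial>lborel)"
      by (simp add: indicator_def)
  qed
  also have "\<dots> = (\<integral>\<^sup>+s. (\<integral>\<^sup>+x. indicator {(x, s). 0 < s \<and> norm x ^ ?n \<le> s \<and> s \<le> f x} (x, s)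
      * ennreal (1 / s) \<partial>lborel) \<partial>lborel)"
    by (intro lborel_pair.Fubini'[symmetric]) measurable
  \<comment> \<open>For fixed \<open>s > 0\<close> the superlevel set of \<open>f\<close> is
    invariant under dilations, so the ball \<open>norm x ^ n \<le> s\<close> cuts from it
    \<open>s\<close> times the volume that the unit ball does; \<open>1 / s\<close> cancels
    again.\<close>
  also have "\<dots> = (\<integral>\<^sup>+s. (\<integral>\<^sup>+x. indicator {(x, s). 0 < s \<and> norm x ^ ?n \<le> 1 \<and> s \<le> f x} (x, s) \<partial>lborel) \<partial>lborel)"
  proof (rule nn_integral_cong)
    fix s :: real
    show "(\<integral>\<^sup>+x. indicator {(x, s). 0 < s \<and> norm x ^ ?n \<le> s \<and> s \<le> f x} (x, s) * ennreal (1 / s) \<partial>lborel)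
      = (\<integral>\<^sup>+x. indicator {(x, s). 0 < s \<and> norm x ^ ?n \<le> 1 \<and> s \<le> f x} (x, s) \<partial>lborel)"
    proof (cases "0 < s")
      case True
      have "(\<integral>\<^sup>+x. indicator {(x, s). 0 < s \<and> norm x ^ ?n \<le> s \<and> s \<le> f x} (x, s) * ennreal (1 / s) \<partial>lborel)
        = (\<integral>\<^sup>+x. indicator {x. norm x ^ ?n / s \<le> 1 \<and> s \<le> f x} x * ennreal (1 / s) \<partial>lborel)"
        using True by (intro nn_integral_cong) (auto simp: indicator_def field_simps)
      also have "\<dots> = emeasure lborel {x. norm x ^ ?n / s \<le> 1 \<and> s \<le> f x} * ennreal (1 / s)"
        using bor by (subst nn_integral_multc) simp_all
      also have "\<dots> = (ennreal s * emeasure lborel {x. norm x ^ ?n \<le> 1 \<and> s \<le> f x}) * ennreal (1 / s)"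
        using emeasure_cone_scale[where P = "\<lambda>a b. a \<le> 1 \<and> s \<le> b" and f = f, OF hom True] bor by simp
      also have "\<dots> = (ennreal s * ennreal (1 / s)) * emeasure lborel {x. norm x ^ ?n \<le> 1 \<and> s \<le> f x}"
        by (simp add: ac_simps)
      also have "ennreal s * ennreal (1 / s) = 1" using True by (simp flip: ennreal_mult')
      also have "1 * emeasure lborel {x. norm x ^ ?n \<le> 1 \<and> s \<le> f x} =
          (\<integral>\<^sup>+x. indicator {x. norm x ^ ?n \<le> 1 \<and> s \<le> f x} x \<partial>lborel)"
        using bor by simp
      also have "\<dots> = (\<integral>\<^sup>+x. indicator {(x, s). 0 < s \<and> norm x ^ ?n \<le> 1 \<and> s \<le> f x} (x, s) \<partial>lborel)"
        using True by (intro nn_integral_cong) (auto simp: indicator_def)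
      finally show ?thesis .
    next
      case False
      then show ?thesis by simp
    qed
  qed
  \<comment> \<open>Layer cake: for fixed \<open>x\<close> in the ball, \<open>s\<close> runs
    through \<open>(0, f x]\<close>, an interval of length \<open>f x\<close>.\<close>
  also have "\<dots> = (\<integral>\<^sup>+x. (\<integral>\<^sup>+s. indicator {(x, s). 0 < s \<and> norm x ^ ?n \<le> 1 \<and> s \<le> f x} (x, s) \<partial>lborel) \<partial>lborel)"
    by (intro lborel_pair.Fubini') measurable
  also have "\<dots> = (\<integral>\<^sup>+x. indicator (cball 0 1) x * ennreal (f x) \<partial>lborel)"
  proof (rule nn_integral_cong)
    fix x :: "real ^ 'n"
    have "(\<integral>\<^sup>+s. indicator {(x, s). 0 < s \<and> norm x ^ ?n \<le> 1 \<and> s \<le> f x} (x, s) \<partial>lborel) =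
      (\<integral>\<^sup>+s. indicator (cball 0 1) x * indicator {0<..f x} s \<partial>lborel)"
      by (intro nn_integral_cong) (auto simp: indicator_def power_le_one_iff)
    also have "\<dots> = indicator (cball 0 1) x * ennreal (f x)"
      using nonneg[of x] by (subst nn_integral_cmult) simp_all
    finally show "(\<integral>\<^sup>+s. indicator {(x, s). 0 < s \<and> norm x ^ ?n \<le> 1 \<and> s \<le> f x} (x, s) \<partial>lborel) =
      indicator (cball 0 1) x * ennreal (f x)" .
  qed
  finally show ?thesis .
qed

section \<open>Integration over the sphere\<close>

text \<open>This is \<open>1 / n\<close> times the integral with respect to the surface measure.\<close>

definition sphere_integral :: "(real ^ 'n \<Rightarrow> real) \<Rightarrow> real" where
  "sphere_integral g = (\<integral>x. indicator (cball 0 1 - {0}) x * g (sgn x) \<partial>lborel)"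

lemma sgn_in_sphere: "x \<noteq> 0 \<Longrightarrow> sgn x \<in> sphere (0 :: real ^ 'n) 1"
  by (simp add: norm_sgn)

text \<open>The radial extension is continuous only off the origin, and \<open>sgn 0 = 0\<close>
  lies outside the sphere, where nothing is known about \<open>g\<close>; hence the
  indicator.\<close>

lemma borel_measurable_radial_extension:
  fixes g :: "real ^ 'n \<Rightarrow> real"
  assumes g: "continuous_on (sphere 0 1) g"
  shows "(\<lambda>x. indicator (- {0}) x * g (sgn x)) \<in> borel_measurable borel"
proof -
  have "continuous_on (- {0}) (\<lambda>x :: real ^ 'n. g (sgn x))"
    by (rule continuous_on_compose2[OF g])
       (auto intro!: continuous_intros simp: norm_sgn split: if_splits)
  then have "(\<lambda>x :: real ^ 'n. indicator (- {0}) x *\<^sub>R g (sgn x)) \<in> borel_measurable borel"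
    by (intro borel_measurable_continuous_on_indicator) auto
  then show ?thesis by simp
qed

lemma integrable_sphere_integral:
  fixes g :: "real ^ 'n \<Rightarrow> real"
  assumes g: "continuous_on (sphere 0 1) g"
  shows "integrable lborel (\<lambda>x. indicator (cball 0 1 - {0}) x * g (sgn x))"
proof -
  obtain B where B: "\<And>u. u \<in> sphere 0 1 \<Longrightarrow> norm (g u) \<le> B"
    using compact_imp_bounded[OF compact_continuous_image[OF g compact_sphere]]
    unfolding bounded_iff by blast
  note [measurable] = borel_measurable_radial_extension[OF g]
  have eq: "(\<lambda>x. indicator (cball 0 1 - {0}) x * g (sgn x)) =
      (\<lambda>x. indicator (cball 0 1) x *\<^sub>R (indicator (- {0}) x * g (sgn x)))"
    by (auto simp: indicator_def)
  have "0 \<le> B" using B[OF sgn_in_sphere[of "axis undefined 1"]] by (simp add: axis_eq_0_iff)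
  show ?thesis unfolding eq
  proof (rule integrableI_bounded_set_indicator[where B = B])
    show "emeasure lborel (cball 0 1 :: (real ^ 'n) set) < \<infinity>"
      by (rule emeasure_bounded_finite) auto
    show "AE x in lborel. x \<in> cball 0 1 \<longrightarrow> norm (indicator (- {0}) x * g (sgn x)) \<le> B"
    proof (intro AE_I2 impI)
      fix x :: "real ^ 'n"
      show "norm (indicator (- {0}) x * g (sgn x)) \<le> B"
        using B[OF sgn_in_sphere[of x]] \<open>0 \<le> B\<close> by (cases "x = 0") auto
    qed
  qed auto
qed

lemma sphere_integral_cong:
  assumes "\<And>u. u \<in> sphere 0 1 \<Longrightarrow> f u = g u"
  shows "sphere_integral f = sphere_integral g"
  unfolding sphere_integral_def
  using assms[OF sgn_in_sphere] by (intro Bochner_Integration.integral_cong) (auto simp: indicator_def)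

lemma sphere_integral_add:
  assumes "continuous_on (sphere 0 1) f" "continuous_on (sphere 0 1) g"
  shows "sphere_integral (\<lambda>u. f u + g u) = sphere_integral f + sphere_integral g"
  unfolding sphere_integral_def
  using assms[THEN integrable_sphere_integral]
  by (simp add: distrib_left)

lemma sphere_integral_cmult:
  "sphere_integral (\<lambda>u. c * f u) = c * sphere_integral f"
proof -
  have "(\<lambda>x. indicator (cball 0 1 - {0}) x * (c * f (sgn x))) =
      (\<lambda>x. c * (indicator (cball 0 1 - {0}) x * f (sgn x)))" by (auto simp: ac_simps)
  then show ?thesis unfolding sphere_integral_def by simp
qed

lemma sphere_integral_nonneg:
  assumes "\<And>u. u \<in> sphere 0 1 \<Longrightarrow> 0 \<le> f u"
  shows "0 \<le> sphere_integral f"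
  unfolding sphere_integral_def
  using assms[OF sgn_in_sphere]
  by (intro Bochner_Integration.integral_nonneg) (auto simp: indicator_def)

text \<open>Vanishing almost everywhere becomes vanishing everywhere by continuity: the points of
  the punctured open ball with \<open>f (sgn x) > 0\<close> form an open set, and a nonempty open
  set is not negligible.\<close>

lemma sphere_integral_eq_0D:
  fixes f :: "real ^ 'n \<Rightarrow> real"
  assumes f: "continuous_on (sphere 0 1) f" "\<And>u. u \<in> sphere 0 1 \<Longrightarrow> 0 \<le> f u"
    and zero: "sphere_integral f = 0" and u: "u \<in> sphere 0 1"
  shows "f u = 0"
proof (rule ccontr)
  assume "f u \<noteq> 0"
  with f(2)[OF u] have pos: "0 < f u" by simp
  let ?S = "(ball 0 1 - {0}) \<inter> (\<lambda>x. f (sgn x)) -` {0<..}"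
  have cont: "continuous_on (ball 0 1 - {0}) (\<lambda>x :: real ^ 'n. f (sgn x))"
    by (rule continuous_on_compose2[OF f(1)])
       (auto intro!: continuous_intros simp: norm_sgn split: if_splits)
  have op: "open ?S"
    by (rule continuous_open_preimage[OF cont]) auto
  \<comment> \<open>The point \<open>u\<close> lies on the boundary of the ball; half of it is
    interior and has the same direction.\<close>
  have "(1/2) *\<^sub>R u \<in> ?S" using u pos by (auto simp: sgn_div_norm)
  then have "\<not> negligible ?S" using op open_not_negligible by blast
  moreover have "AE x in lborel. indicator (cball 0 1 - {0}) x * f (sgn x) = 0"
    using zero integral_nonneg_eq_0_iff_AE[OF integrable_sphere_integral[OF f(1)]]
      f(2)[OF sgn_in_sphere]
    by (auto simp: sphere_integral_def indicator_def)
  then have "AE x in lborel. x \<notin> ?S"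
    by eventually_elim (auto simp: indicator_def)
  then have "?S \<in> null_sets lborel"
    using op AE_iff_null_sets[of ?S lborel] by simp
  then have "negligible ?S"
    by (simp add: negligible_iff_null_sets null_sets_completionI)
  ultimately show False by blast
qed

text \<open>For \<open>x \<noteq> 0\<close>, membership in \<open>K\<close> means
  \<open>norm x \<le> radial K (sgn x)\<close>; its \<open>n\<close>-th power is the inequality of
  \<open>emeasure_cone_body\<close>. Setting \<open>f 0 = 0\<close> keeps the origin in the set, as
  \<open>0 ^ n = 0\<close>.\<close>

lemma measure_star_body:
  fixes K :: "(real ^ 'n) set"
  assumes K: "K \<in> star_bodies"
  shows "measure lebesgue K = sphere_integral (\<lambda>u. radial K u ^ CARD('n))"
proof -
  have c: "compact K" "0 \<in> K" "continuous_on (sphere 0 1) (radial K)"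
    using K by (auto simp: star_bodies_def)
  define f where "f x = indicator (- {0}) x * radial K (sgn x) ^ CARD('n)" for x
  have rad: "0 \<le> radial K (sgn x)" if "x \<noteq> 0" for x
    by (rule radial_attained(1)[OF c(1,2) sgn_in_sphere[OF that]])
  have f[measurable]: "f \<in> borel_measurable borel"
    unfolding f_def using c by (intro borel_measurable_radial_extension continuous_intros)
  have nonneg: "0 \<le> f x" for x using rad[of x] by (auto simp: f_def indicator_def)
  have K_eq: "K = {x. norm x ^ CARD('n) \<le> f x}"
  proof (intro set_eqI)
    fix x
    show "x \<in> K \<longleftrightarrow> x \<in> {x. norm x ^ CARD('n) \<le> f x}"
    proof (cases "x = 0")
      case False
      have "norm x *\<^sub>R sgn x = x" using False by (simp add: sgn_div_norm)
      then have "norm x \<le> radial K (sgn x)" if "x \<in> K"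
        using radial_attained(3)[OF c(1,2) sgn_in_sphere[OF False], of "norm x"] that by simp
      moreover have "x \<in> K" if "norm x \<le> radial K (sgn x)"
        by (subst star_body_eq[OF K])
           (use that \<open>norm x *\<^sub>R sgn x = x\<close> sgn_in_sphere[OF False] norm_ge_zero[of x]
             in \<open>metis (mono_tags, lifting) mem_Collect_eq\<close>)
      ultimately show ?thesis
        using False rad[OF False] by (auto simp: f_def power_mono_iff)
    qed (use c in \<open>simp add: f_def power_0_left\<close>)
  qed
  have "emeasure lborel K = (\<integral>\<^sup>+x. indicator (cball 0 1) x * ennreal (f x) \<partial>lborel)"
    unfolding K_eq
    by (rule emeasure_cone_body[OF _ nonneg f]) (auto simp: f_def indicator_def sgn_scaleR)
  also have "\<dots> = (\<integral>\<^sup>+x. ennreal (indicator (cball 0 1 - {0}) x * radial K (sgn x) ^ CARD('n)) \<partial>lborel)"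
    by (intro nn_integral_cong) (auto simp: f_def indicator_def)
  also have "\<dots> = ennreal (sphere_integral (\<lambda>u. radial K u ^ CARD('n)))"
    unfolding sphere_integral_def using c rad
    by (intro nn_integral_eq_integral integrable_sphere_integral continuous_intros)
       (auto simp: indicator_def)
  finally have "emeasure lborel K = ennreal (sphere_integral (\<lambda>u. radial K u ^ CARD('n)))" .
  moreover have "0 \<le> sphere_integral (\<lambda>u. radial K u ^ CARD('n))"
    by (intro sphere_integral_nonneg zero_le_power radial_attained(1)[OF c(1,2)])
  ultimately have "measure lborel K = sphere_integral (\<lambda>u. radial K u ^ CARD('n))"
    by (simp add: measure_def)
  then show ?thesis using c by (simp add: compact_imp_closed)
qed

section \<open>Integral Cauchy-Schwarz inequality\<close>

text \<open>The quadratic is evaluated at its minimiser \<open>t / a\<close>, which is nonnegative.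
  If \<open>a = 0\<close>, a linear function of \<open>s\<close> with slope \<open>2 * t\<close> is
  bounded by \<open>b\<close>, and \<open>s = (b + 1) / t\<close> refutes
  \<open>t > 0\<close>.\<close>

lemma discriminant_le:
  fixes a b t :: real
  assumes nonneg: "0 \<le> a" "0 \<le> t" and le: "\<And>s. 0 \<le> s \<Longrightarrow> 2 * s * t \<le> s\<^sup>2 * a + b"
  shows "t\<^sup>2 \<le> a * b"
proof (cases "a = 0")
  case True
  have "t = 0"
  proof (rule ccontr)
    assume "t \<noteq> 0"
    with nonneg have "0 < t" by simp
    moreover have "0 \<le> b" using le[of 0] by simp
    ultimately show False using le[of "(b + 1) / t"] True by simp
  qed
  with True show ?thesis by simp
next
  case False
  then have "0 < a" using nonneg by simp
  moreover from this have "2 * (t / a) * t \<le> (t / a)\<^sup>2 * a + b" using nonneg by (intro le) simp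
  ultimately show ?thesis by (simp add: field_simps power2_eq_square)
qed

text \<open>AM-GM for \<open>s^2 * p\<close> and \<open>q\<close>, carried out on squares because
  the right-hand side is nonnegative.\<close>

lemma two_mult_le_if_square_le:
  fixes p q s w :: real
  assumes "0 \<le> p" "0 \<le> q" "w\<^sup>2 \<le> p * q"
  shows "2 * s * w \<le> s\<^sup>2 * p + q"
proof (rule power2_le_imp_le)
  have "(2 * s * w)\<^sup>2 = 4 * s\<^sup>2 * w\<^sup>2" by (simp add: power_mult_distrib)
  also have "\<dots> \<le> 4 * s\<^sup>2 * (p * q)" using assms by (intro mult_left_mono) auto
  also have "\<dots> \<le> (s\<^sup>2 * p + q)\<^sup>2"
    using zero_le_power2[of "s\<^sup>2 * p - q"] by (simp add: power2_eq_square algebra_simps)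
  finally show "(2 * s * w)\<^sup>2 \<le> (s\<^sup>2 * p + q)\<^sup>2" .
qed (use assms in simp)

text \<open>Under the equation, \<open>(s^2 * p - q)^2\<close> equals
  \<open>4 * s^2 * (w^2 - p * q)\<close>, which is at most 0.\<close>

lemma two_mult_eqD:
  fixes p q s w :: real
  assumes "w\<^sup>2 \<le> p * q" "0 < s" and eq: "2 * s * w = s\<^sup>2 * p + q"
  shows "q = s\<^sup>2 * p" "w = s * p"
proof -
  have "(s\<^sup>2 * p - q)\<^sup>2 = (2 * s * w)\<^sup>2 - 4 * s\<^sup>2 * (p * q)"
    unfolding eq by (simp add: power2_eq_square algebra_simps)
  also have "\<dots> = 4 * s\<^sup>2 * (w\<^sup>2 - p * q)" by (simp add: power_mult_distrib algebra_simps)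
  also have "\<dots> \<le> 0" using assms by (intro mult_nonneg_nonpos) auto
  finally show q: "q = s\<^sup>2 * p" by simp
  have "s * w = s * (s * p)" using eq unfolding q by (simp add: power2_eq_square ac_simps)
  with \<open>0 < s\<close> show "w = s * p" by (metis mult_left_cancel order_less_irrefl)
qed

context
  fixes p q w :: "real ^ 'n \<Rightarrow> real"
  assumes cont: "continuous_on (sphere 0 1) p" "continuous_on (sphere 0 1) q"
      "continuous_on (sphere 0 1) w"
    and nonneg: "\<And>u. u \<in> sphere 0 1 \<Longrightarrow> 0 \<le> p u" "\<And>u. u \<in> sphere 0 1 \<Longrightarrow> 0 \<le> q u"
      "\<And>u. u \<in> sphere 0 1 \<Longrightarrow> 0 \<le> w u"
    and le: "\<And>u. u \<in> sphere 0 1 \<Longrightarrow> (w u)\<^sup>2 \<le> p u * q u"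
begin

lemma sphere_integral_square_expand:
  "sphere_integral (\<lambda>u. s\<^sup>2 * p u + q u + (- 2 * s) * w u) =
     s\<^sup>2 * sphere_integral p + sphere_integral q - 2 * s * sphere_integral w"
proof -
  have c: "continuous_on (sphere 0 1) (\<lambda>u. s\<^sup>2 * p u)"
    "continuous_on (sphere 0 1) (\<lambda>u. (- 2 * s) * w u)"
    "continuous_on (sphere 0 1) (\<lambda>u. s\<^sup>2 * p u + q u)"
    by (intro continuous_intros cont)+
  show ?thesis
    unfolding sphere_integral_add[OF c(3,2)] sphere_integral_add[OF c(1) cont(2)]
      sphere_integral_cmult by simp
qed

text \<open>Only \<open>w^2 \<le> p * q\<close> is assumed pointwise, since \<open>w\<close> will be
  a power of \<open>T (r1 r2 h)\<close>, for which no pointwise equality is available.\<close>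

lemma sphere_integral_Cauchy_Schwarz:
  "(sphere_integral w)\<^sup>2 \<le> sphere_integral p * sphere_integral q"
proof (rule discriminant_le)
  fix s :: real
  have "0 \<le> sphere_integral (\<lambda>u. s\<^sup>2 * p u + q u + (- 2 * s) * w u)"
    using two_mult_le_if_square_le[OF nonneg(1,2) le]
    by (intro sphere_integral_nonneg) (simp add: algebra_simps)
  then show "2 * s * sphere_integral w \<le> s\<^sup>2 * sphere_integral p + sphere_integral q"
    unfolding sphere_integral_square_expand by simp
qed (intro sphere_integral_nonneg nonneg; assumption)+

text \<open>The integral of \<open>s^2 * p + q - 2 * s * w\<close> is a quadratic polynomial in
  \<open>s\<close> whose minimum is 0 in the equality case. At the minimiser the nonnegative
  continuous integrand vanishes at every \<open>u\<close>, so the same \<open>s\<close> serves the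
  whole sphere.\<close>

lemma sphere_integral_Cauchy_Schwarz_eqD:
  assumes eq: "(sphere_integral w)\<^sup>2 = sphere_integral p * sphere_integral q"
    and pos: "0 < sphere_integral p" "0 < sphere_integral q"
  obtains s where "0 < s" "\<And>u. u \<in> sphere 0 1 \<Longrightarrow> q u = s\<^sup>2 * p u"
    "\<And>u. u \<in> sphere 0 1 \<Longrightarrow> w u = s * p u"
proof -
  define s where "s = sphere_integral w / sphere_integral p"
  have "sphere_integral w \<noteq> 0" using eq pos by auto
  moreover have "0 \<le> sphere_integral w" by (intro sphere_integral_nonneg nonneg)
  ultimately have s: "0 < s" using pos by (simp add: s_def)
  have zero: "sphere_integral (\<lambda>u. s\<^sup>2 * p u + q u + (- 2 * s) * w u) = 0"
    unfolding sphere_integral_square_expand s_def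
    using eq pos by (simp add: field_simps power2_eq_square)
  have "s\<^sup>2 * p u + q u + (- 2 * s) * w u = 0" if "u \<in> sphere 0 1" for u
  proof (rule sphere_integral_eq_0D[OF _ _ zero that])
    show "continuous_on (sphere 0 1) (\<lambda>u. s\<^sup>2 * p u + q u + (- 2 * s) * w u)"
      using cont by (intro continuous_intros)
    show "0 \<le> s\<^sup>2 * p u + q u + (- 2 * s) * w u" if "u \<in> sphere 0 1" for u
      using two_mult_le_if_square_le[OF nonneg(1,2)[OF that] le[OF that], of s] by simp
  qed
  then have "2 * s * w u = s\<^sup>2 * p u + q u" if "u \<in> sphere 0 1" for u using that by force
  with two_mult_eqD[OF le s] s that show ?thesis by blast
qed

end

section \<open>Positive operators commuting with rotations\<close>

text \<open>These are the possible \<open>(n - 1)\<close>-st powers of radial functions. Values off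
  the sphere are unconstrained, so distinct elements may represent the same function on the
  sphere.\<close>

definition sphere_cone :: "(real ^ 'n \<Rightarrow> real) set" where
  "sphere_cone = {f. continuous_on (sphere 0 1) f \<and> (\<forall>u\<in>sphere 0 1. 0 \<le> f u)}"

lemma sphere_coneI:
  "continuous_on (sphere 0 1) f \<Longrightarrow> (\<And>u. u \<in> sphere 0 1 \<Longrightarrow> 0 \<le> f u) \<Longrightarrow> f \<in> sphere_cone"
  by (simp add: sphere_cone_def)

lemma sphere_coneD:
  assumes "f \<in> sphere_cone"
  shows "continuous_on (sphere 0 1) f" "\<And>u. u \<in> sphere 0 1 \<Longrightarrow> 0 \<le> f u"
  using assms by (auto simp: sphere_cone_def)

lemma sphere_cone_const: "0 \<le> c \<Longrightarrow> (\<lambda>_. c) \<in> sphere_cone"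
  and sphere_cone_add: "f \<in> sphere_cone \<Longrightarrow> g \<in> sphere_cone \<Longrightarrow> (\<lambda>u. f u + g u) \<in> sphere_cone"
  and sphere_cone_mult: "f \<in> sphere_cone \<Longrightarrow> g \<in> sphere_cone \<Longrightarrow> (\<lambda>u. f u * g u) \<in> sphere_cone"
  and sphere_cone_power: "f \<in> sphere_cone \<Longrightarrow> (\<lambda>u. f u ^ k) \<in> sphere_cone"
  by (auto simp: sphere_cone_def intro!: continuous_intros)

lemma sphere_cone_diff:
  "f \<in> sphere_cone \<Longrightarrow> g \<in> sphere_cone \<Longrightarrow> (\<And>u. u \<in> sphere 0 1 \<Longrightarrow> g u \<le> f u) \<Longrightarrow>
    (\<lambda>u. f u - g u) \<in> sphere_cone"
  by (auto simp: sphere_cone_def intro!: continuous_intros)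

lemma sphere_cone_sum:
  "(\<And>i. i \<in> I \<Longrightarrow> f i \<in> sphere_cone) \<Longrightarrow> (\<lambda>u. \<Sum>i\<in>I. f i u) \<in> sphere_cone"
  by (auto simp: sphere_cone_def intro!: continuous_intros sum_nonneg)

lemma sphere_cone_prod:
  "(\<And>i. i \<in> I \<Longrightarrow> f i \<in> sphere_cone) \<Longrightarrow> (\<lambda>u. \<Prod>i\<in>I. f i u) \<in> sphere_cone"
  by (auto simp: sphere_cone_def intro!: continuous_intros prod_nonneg)

lemma rotation_matrix_transpose: "rotation_matrix A \<Longrightarrow> rotation_matrix (transpose A)"
  by (simp add: rotation_matrix_def orthogonal_matrix_transpose)

lemma norm_rotation_matrix:
  fixes A :: "real ^ 'n ^ 'n"
  assumes "rotation_matrix A"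
  shows "norm (A *v x) = norm x"
  using assms orthogonal_transformation_norm[of "(*v) A" x]
  by (simp add: rotation_matrix_def orthogonal_transformation_matrix)

lemma sphere_cone_rotate:
  assumes f: "f \<in> sphere_cone" and A: "rotation_matrix (A :: real ^ 'n ^ 'n)"
  shows "(\<lambda>v. f (A *v v)) \<in> sphere_cone"
proof (rule sphere_coneI)
  show "continuous_on (sphere 0 1) (\<lambda>v. f (A *v v))"
    by (rule continuous_on_compose2[OF sphere_coneD(1)[OF f]])
       (auto simp: norm_rotation_matrix[OF A] intro!: linear_continuous_on matrix_vector_mul_bounded_linear)
  show "0 \<le> f (A *v u)" if "u \<in> sphere 0 1" for u
    using that by (intro sphere_coneD(2)[OF f]) (simp add: norm_rotation_matrix[OF A])
qed

locale sphere_operator =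
  fixes T :: "(real ^ 'n \<Rightarrow> real) \<Rightarrow> real ^ 'n \<Rightarrow> real"
  assumes in_cone: "f \<in> sphere_cone \<Longrightarrow> T f \<in> sphere_cone"
    and add: "f \<in> sphere_cone \<Longrightarrow> g \<in> sphere_cone \<Longrightarrow> u \<in> sphere 0 1 \<Longrightarrow>
      T (\<lambda>v. f v + g v) u = T f u + T g u"
    and rotate: "f \<in> sphere_cone \<Longrightarrow> rotation_matrix A \<Longrightarrow> u \<in> sphere 0 1 \<Longrightarrow>
      T (\<lambda>v. f (A *v v)) u = T f (A *v u)"
begin

lemma nonneg: "f \<in> sphere_cone \<Longrightarrow> u \<in> sphere 0 1 \<Longrightarrow> 0 \<le> T f u"
  using sphere_coneD(2)[OF in_cone] .

lemma mono:
  assumes f: "f \<in> sphere_cone" and g: "g \<in> sphere_cone" and u: "u \<in> sphere 0 1"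
    and le: "\<And>v. v \<in> sphere 0 1 \<Longrightarrow> f v \<le> g v"
  shows "T f u \<le> T g u"
proof -
  have d: "(\<lambda>v. g v - f v) \<in> sphere_cone" by (rule sphere_cone_diff[OF g f le])
  have "T (\<lambda>v. f v + (g v - f v)) u = T f u + T (\<lambda>v. g v - f v) u"
    by (rule add[OF f d u])
  with nonneg[OF d u] show ?thesis by simp
qed

text \<open>Monotonicity in both directions shows that \<open>T\<close> sees only the restriction of
  a function to the sphere.\<close>

lemma cong:
  assumes "f \<in> sphere_cone" "g \<in> sphere_cone" "u \<in> sphere 0 1"
    "\<And>v. v \<in> sphere 0 1 \<Longrightarrow> f v = g v"
  shows "T f u = T g u"
  using assms by (intro antisym mono) simp_all

lemma zero: "u \<in> sphere 0 1 \<Longrightarrow> T (\<lambda>_. 0) u = 0"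
  using add[of "\<lambda>_. 0" "\<lambda>_. 0" u] sphere_cone_const[of 0] by simp

lemma scale_nat:
  assumes f: "f \<in> sphere_cone" and u: "u \<in> sphere 0 1"
  shows "T (\<lambda>v. real k * f v) u = real k * T f u"
proof (induction k)
  case 0
  show ?case using zero[OF u] by simp
next
  case (Suc k)
  have "T (\<lambda>v. real k * f v + f v) u = T (\<lambda>v. real k * f v) u + T f u"
    using f u by (intro add sphere_cone_mult sphere_cone_const) simp_all
  with Suc show ?case by (simp add: algebra_simps)
qed

text \<open>Real factors are reached by squeezing: with \<open>k\<close> the integer part of
  \<open>N * c\<close>, both \<open>N * t\<close> and \<open>N * c * x\<close> lie between
  \<open>k * x\<close> and \<open>(k + 1) * x\<close>. So \<open>N\<close> times their discrepancy
  \<open>t - c * x\<close> is at most \<open>x\<close> in absolute value for every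
  \<open>N\<close>.\<close>

lemma scale:
  assumes f: "f \<in> sphere_cone" and u: "u \<in> sphere 0 1" and c: "0 \<le> c"
  shows "T (\<lambda>v. c * f v) u = c * T f u"
proof -
  define t where "t = T (\<lambda>v. c * f v) u"
  define x where "x = T f u"
  have x: "0 \<le> x" unfolding x_def by (rule nonneg[OF f u])
  have cf: "(\<lambda>v. d * f v) \<in> sphere_cone" if "0 \<le> d" for d
    using f that by (intro sphere_cone_mult sphere_cone_const)
  have bound: "real N * \<bar>t - c * x\<bar> \<le> x" for N
  proof -
    define k where "k = nat \<lfloor>real N * c\<rfloor>"
    have k: "real k \<le> real N * c" "real N * c \<le> real (Suc k)"
      using c unfolding k_def by (simp_all, linarith)
    have N: "T (\<lambda>v. real N * (c * f v)) u = real N * t"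
      unfolding t_def by (rule scale_nat[OF cf[OF c] u])
    have Ncone: "(\<lambda>v. real N * (c * f v)) \<in> sphere_cone"
      using c by (intro sphere_cone_mult[OF sphere_cone_const] cf) simp_all
    have "real k * x \<le> real N * t"
      unfolding N[symmetric] x_def scale_nat[OF f u, symmetric]
    proof (rule mono[OF _ Ncone u])
      fix v assume "v \<in> sphere (0 :: real ^ 'n) 1"
      from mult_right_mono[OF k(1) sphere_coneD(2)[OF f this]]
      show "real k * f v \<le> real N * (c * f v)" by (simp add: mult.assoc)
    qed (simp add: cf)
    moreover have "real N * t \<le> real (Suc k) * x"
      unfolding N[symmetric] x_def scale_nat[OF f u, symmetric]
    proof (rule mono[OF Ncone _ u])
      fix v assume "v \<in> sphere (0 :: real ^ 'n) 1"
      from mult_right_mono[OF k(2) sphere_coneD(2)[OF f this]]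
      show "real N * (c * f v) \<le> real (Suc k) * f v" by (simp add: mult.assoc)
    qed (rule cf, simp)
    moreover have "real k * x \<le> real N * (c * x)" "real N * (c * x) \<le> real (Suc k) * x"
      using mult_right_mono[OF k(1) x] mult_right_mono[OF k(2) x] by (simp_all add: mult.assoc)
    moreover have "real (Suc k) * x = real k * x + x" by (simp add: algebra_simps)
    ultimately have "\<bar>real N * t - real N * (c * x)\<bar> \<le> x" by linarith
    then show ?thesis by (simp add: abs_mult flip: right_diff_distrib)
  qed
  have "t = c * x"
  proof (rule ccontr)
    assume "t \<noteq> c * x"
    then obtain N where "x < real N * \<bar>t - c * x\<bar>"
      using reals_Archimedean3[of "\<bar>t - c * x\<bar>"] by auto
    with bound[of N] show False by simp
  qed
  then show ?thesis by (simp add: t_def x_def)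
qed

lemma sum:
  assumes "finite I" "\<And>i. i \<in> I \<Longrightarrow> f i \<in> sphere_cone" "u \<in> sphere 0 1"
  shows "T (\<lambda>v. \<Sum>i\<in>I. f i v) u = (\<Sum>i\<in>I. T (f i) u)"
  using assms
proof (induction I rule: finite_induct)
  case empty
  then show ?case by (simp add: zero)
next
  case (insert i I)
  then have "T (\<lambda>v. f i v + (\<Sum>i\<in>I. f i v)) u = T (f i) u + T (\<lambda>v. \<Sum>i\<in>I. f i v) u"
    by (intro add sphere_cone_sum) simp_all
  with insert show ?case by simp
qed

text \<open>Finitely many rotates of a cap on which \<open>\<phi>\<close> is positive cover the sphere.\<close>

lemma eq_0_if_eq_0_at_nonzero:
  assumes n: "2 \<le> CARD('n)"
    and \<phi>: "\<phi> \<in> sphere_cone" "\<And>u. u \<in> sphere 0 1 \<Longrightarrow> T \<phi> u = 0"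
    and x: "x \<in> sphere 0 1" "\<phi> x \<noteq> 0"
    and f: "f \<in> sphere_cone" and u: "u \<in> sphere 0 1"
  shows "T f u = 0"
proof -
  \<comment> \<open>Rotations act transitively on the sphere from dimension 2 on; in dimension 1
    only the identity is a rotation.\<close>
  have "\<exists>A. rotation_matrix A \<and> A *v v = x" if v: "v \<in> sphere 0 1" for v
  proof -
    obtain g where g: "orthogonal_transformation g" "det (matrix g) = 1" "g v = x"
      using rotation_exists_1[OF n, of v x] v x by auto
    then have "matrix g *v v = x"
      by (simp add: matrix_works orthogonal_transformation_linear)
    with g show ?thesis
      by (auto simp: rotation_matrix_def orthogonal_transformation_matrix intro!: exI[of _ "matrix g"])
  qed
  then obtain A where A: "\<And>v. v \<in> sphere 0 1 \<Longrightarrow> rotation_matrix (A v)"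
    "\<And>v. v \<in> sphere 0 1 \<Longrightarrow> A v *v v = x" by metis
  \<comment> \<open>The rotate \<open>\<psi> v\<close> takes at \<open>v\<close> the value
    \<open>\<phi> x\<close>, so it is positive near \<open>v\<close> on the sphere.\<close>
  define \<psi> where "\<psi> v w = \<phi> (A v *v w)" for v w
  have \<psi>: "\<psi> v \<in> sphere_cone" if "v \<in> sphere 0 1" for v
    unfolding \<psi>_def by (rule sphere_cone_rotate[OF \<phi>(1) A(1)[OF that]])
  have T\<psi>: "T (\<psi> v) w = 0" if "v \<in> sphere 0 1" "w \<in> sphere 0 1" for v w
    unfolding \<psi>_def using rotate[OF \<phi>(1) A(1)[OF that(1)] that(2)] that(2)
    by (simp add: \<phi>(2) norm_rotation_matrix[OF A(1)[OF that(1)]])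
  \<comment> \<open>Continuity on the sphere makes the positivity set only relatively open;
    \<open>U\<close> is an ambient open set with that trace, as the covering argument
    requires.\<close>
  have "\<exists>U. open U \<and> U \<inter> sphere 0 1 = \<psi> v -` {0<..} \<inter> sphere 0 1" if "v \<in> sphere 0 1" for v
    using iffD1[OF continuous_on_open_invariant sphere_coneD(1)[OF \<psi>[OF that]]]
    by (simp only: open_greaterThan)
  then obtain U where U: "\<And>v. v \<in> sphere 0 1 \<Longrightarrow> open (U v)"
    "\<And>v. v \<in> sphere 0 1 \<Longrightarrow> U v \<inter> sphere 0 1 = \<psi> v -` {0<..} \<inter> sphere 0 1" by metis
  have pos: "0 < \<psi> v v" if "v \<in> sphere 0 1" for v
    using sphere_coneD(2)[OF \<phi>(1) x(1)] x(2) by (simp add: \<psi>_def A(2)[OF that])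
  have "sphere 0 1 \<subseteq> (\<Union>v\<in>sphere 0 1. U v)" using pos U(2) by fastforce
  then obtain D where D: "D \<subseteq> sphere 0 1" "finite D" "sphere 0 1 \<subseteq> (\<Union>v\<in>D. U v)"
    using compactE_image[OF compact_sphere, of "sphere 0 1" U] U(1) by metis
  define g where "g w = (\<Sum>v\<in>D. \<psi> v w)" for w
  have g: "g \<in> sphere_cone" unfolding g_def using D \<psi> by (intro sphere_cone_sum) auto
  have g_pos: "0 < g w" if w: "w \<in> sphere 0 1" for w
  proof -
    obtain v where "v \<in> D" "w \<in> U v" using D w by blast
    with D U(2) w have "0 < \<psi> v w" by blast
    moreover have "0 \<le> \<psi> i w" if "i \<in> D" for i using D that by (intro sphere_coneD(2)[OF \<psi> w]) auto
    ultimately show ?thesis unfolding g_def using D \<open>v \<in> D\<close> by (intro sum_pos2[of _ v])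
  qed
  have ne: "sphere (0 :: real ^ 'n) 1 \<noteq> {}" using u by blast
  obtain y where y: "y \<in> sphere 0 1" "\<And>w. w \<in> sphere 0 1 \<Longrightarrow> g y \<le> g w"
    using continuous_attains_inf[OF compact_sphere ne sphere_coneD(1)[OF g]] by blast
  obtain z where z: "z \<in> sphere 0 1" "\<And>w. w \<in> sphere 0 1 \<Longrightarrow> f w \<le> f z"
    using continuous_attains_sup[OF compact_sphere ne sphere_coneD(1)[OF f]] by blast
  \<comment> \<open>The maximum of \<open>f\<close> over the minimum of \<open>g\<close>, which is
    positive by compactness; this gives \<open>f \<le> C * g\<close> on the sphere.\<close>
  define C where "C = f z / g y"
  have C: "0 \<le> C" unfolding C_def using g_pos[OF y(1)] sphere_coneD(2)[OF f z(1)] by simp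
  have "f w \<le> C * g w" if w: "w \<in> sphere 0 1" for w
  proof -
    have "f w \<le> C * g y" unfolding C_def using z(2)[OF w] g_pos[OF y(1)] by simp
    also have "\<dots> \<le> C * g w" using C y(2)[OF w] by (rule mult_left_mono[rotated])
    finally show ?thesis .
  qed
  then have "T f u \<le> T (\<lambda>w. C * g w) u"
    using f g C u by (intro mono sphere_cone_mult[OF sphere_cone_const]) auto
  also have "\<dots> = C * T g u" by (rule scale[OF g u C])
  also have "T g u = (\<Sum>v\<in>D. T (\<psi> v) u)"
    unfolding g_def using D \<psi> u by (intro sum) auto
  also have "\<dots> = 0" using D T\<psi> u by (intro sum.neutral) auto
  finally show ?thesis using nonneg[OF f u] by simp
qed

section \<open>The weighted form \<open>T (r s h)\<close> and its Cauchy-Schwarz inequality\<close>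

context
  fixes r1 r2 h :: "real ^ 'n \<Rightarrow> real"
  assumes cone: "r1 \<in> sphere_cone" "r2 \<in> sphere_cone" "h \<in> sphere_cone"
begin

abbreviation (input) form where "form r s \<equiv> T (\<lambda>v. r v * s v * h v)"

lemma products_in_cone:
  "(\<lambda>v. r1 v * r1 v * h v) \<in> sphere_cone" "(\<lambda>v. r2 v * r2 v * h v) \<in> sphere_cone"
  "(\<lambda>v. r1 v * r2 v * h v) \<in> sphere_cone"
  by (intro sphere_cone_mult cone)+

lemma square_in_cone: "(\<lambda>v. (k * r1 v - r2 v)\<^sup>2 * h v) \<in> sphere_cone"
  using cone by (auto simp: sphere_cone_def intro!: continuous_intros)

text \<open>The cross term enters the square with a negative sign, so \<open>T\<close> cannot be
  split over the expansion. It is added to both sides first, and additivity is then applied to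
  elements of the cone only.\<close>

lemma square_expand:
  assumes k: "0 \<le> k" and u: "u \<in> sphere 0 1"
  shows "T (\<lambda>v. (k * r1 v - r2 v)\<^sup>2 * h v) u = k\<^sup>2 * form r1 r1 u - 2 * k * form r1 r2 u + form r2 r2 u"
proof -
  have c: "(\<lambda>v. 2 * k * (r1 v * r2 v * h v)) \<in> sphere_cone"
    "(\<lambda>v. k\<^sup>2 * (r1 v * r1 v * h v)) \<in> sphere_cone"
    using k by (intro sphere_cone_mult[OF sphere_cone_const] products_in_cone; simp)+
  have "T (\<lambda>v. (k * r1 v - r2 v)\<^sup>2 * h v) u + 2 * k * form r1 r2 u =
      T (\<lambda>v. (k * r1 v - r2 v)\<^sup>2 * h v + 2 * k * (r1 v * r2 v * h v)) u"
    using add[OF square_in_cone c(1) u] scale[OF products_in_cone(3) u, of "2 * k"] k by simp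
  also have "(\<lambda>v. (k * r1 v - r2 v)\<^sup>2 * h v + 2 * k * (r1 v * r2 v * h v)) =
      (\<lambda>v. k\<^sup>2 * (r1 v * r1 v * h v) + r2 v * r2 v * h v)"
    by (auto simp: power2_eq_square algebra_simps)
  also have "T \<dots> u = k\<^sup>2 * form r1 r1 u + form r2 r2 u"
    using add[OF c(2) products_in_cone(2) u] scale[OF products_in_cone(1) u, of "k\<^sup>2"] by simp
  finally show ?thesis by simp
qed

lemma pointwise_Cauchy_Schwarz:
  assumes u: "u \<in> sphere 0 1"
  shows "(form r1 r2 u)\<^sup>2 \<le> form r1 r1 u * form r2 r2 u"
proof (rule discriminant_le)
  show "2 * s * form r1 r2 u \<le> s\<^sup>2 * form r1 r1 u + form r2 r2 u" if "0 \<le> s" for s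
    using nonneg[OF square_in_cone u, of s] square_expand[OF that u] by simp
qed (intro nonneg products_in_cone u)+

lemma power_Cauchy_Schwarz:
  assumes u: "u \<in> sphere 0 1"
  shows "(form r1 r2 u ^ m)\<^sup>2 \<le> form r1 r1 u ^ m * form r2 r2 u ^ m"
proof -
  have "((form r1 r2 u)\<^sup>2) ^ m \<le> (form r1 r1 u * form r2 r2 u) ^ m"
    by (intro power_mono pointwise_Cauchy_Schwarz u) simp
  then show ?thesis by (simp add: power_mult_distrib mult.commute flip: power_mult)
qed

lemmas powers_in_cone = products_in_cone[THEN in_cone, THEN sphere_cone_power]

lemma integral_inequality:
  "(sphere_integral (\<lambda>u. form r1 r2 u ^ m))\<^sup>2 \<le>
     sphere_integral (\<lambda>u. form r1 r1 u ^ m) * sphere_integral (\<lambda>u. form r2 r2 u ^ m)"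
  by (intro sphere_integral_Cauchy_Schwarz sphere_coneD powers_in_cone power_Cauchy_Schwarz)

lemma integral_equalityD:
  assumes n: "2 \<le> CARD('n)" and m: "0 < m"
    and nontrivial: "f \<in> sphere_cone" "x \<in> sphere 0 1" "T f x \<noteq> 0"
    and h: "\<And>u. u \<in> sphere 0 1 \<Longrightarrow> 0 < h u"
    and r: "\<exists>u\<in>sphere 0 1. r1 u \<noteq> 0" "\<exists>u\<in>sphere 0 1. r2 u \<noteq> 0"
    and eq: "(sphere_integral (\<lambda>u. form r1 r2 u ^ m))\<^sup>2 =
      sphere_integral (\<lambda>u. form r1 r1 u ^ m) * sphere_integral (\<lambda>u. form r2 r2 u ^ m)"
  obtains k where "0 < k" "\<And>u. u \<in> sphere 0 1 \<Longrightarrow> r2 u = k * r1 u"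
proof -
  have inj: "\<phi> u = 0" if "\<phi> \<in> sphere_cone" "\<And>u. u \<in> sphere 0 1 \<Longrightarrow> T \<phi> u = 0"
    "u \<in> sphere 0 1" for \<phi> u
    using eq_0_if_eq_0_at_nonzero[OF n that(1,2) that(3) _ nontrivial(1,2)] nontrivial(3) by blast
  \<comment> \<open>The equality case of the integral inequality divides by these integrals. If one
    vanished, then so would \<open>T (r^2 h)\<close>, hence \<open>r^2 h\<close>, and with
    \<open>h > 0\<close> also \<open>r\<close>.\<close>
  have pos: "0 < sphere_integral (\<lambda>u. T (\<lambda>v. r v * r v * h v) u ^ m)"
    if r: "r \<in> sphere_cone" "\<exists>u\<in>sphere 0 1. r u \<noteq> 0" for r
  proof (rule ccontr)
    have c: "(\<lambda>v. r v * r v * h v) \<in> sphere_cone"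
      using r(1) cone(3) by (intro sphere_cone_mult)
    note c' = sphere_coneD[OF sphere_cone_power[OF in_cone[OF c], of m]]
    assume "\<not> ?thesis"
    with sphere_integral_nonneg[of "\<lambda>u. T (\<lambda>v. r v * r v * h v) u ^ m", OF c'(2)]
    have "sphere_integral (\<lambda>u. T (\<lambda>v. r v * r v * h v) u ^ m) = 0" by linarith
    from sphere_integral_eq_0D[OF c' this]
    have "T (\<lambda>v. r v * r v * h v) u = 0" if "u \<in> sphere 0 1" for u using that m by simp
    from inj[OF c this] have "r u * r u * h u = 0" if "u \<in> sphere 0 1" for u using that by blast
    with h r(2) show False by fastforce
  qed
  obtain s where s: "0 < s" "\<And>u. u \<in> sphere 0 1 \<Longrightarrow> form r2 r2 u ^ m = s\<^sup>2 * form r1 r1 u ^ m"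
    "\<And>u. u \<in> sphere 0 1 \<Longrightarrow> form r1 r2 u ^ m = s * form r1 r1 u ^ m"
    by (rule sphere_integral_Cauchy_Schwarz_eqD[OF sphere_coneD(1)[OF powers_in_cone(1)]
        sphere_coneD(1)[OF powers_in_cone(2)] sphere_coneD(1)[OF powers_in_cone(3)]
        sphere_coneD(2)[OF powers_in_cone(1)] sphere_coneD(2)[OF powers_in_cone(2)]
        sphere_coneD(2)[OF powers_in_cone(3)] power_Cauchy_Schwarz eq
        pos[OF cone(1) r(1)] pos[OF cone(2) r(2)]]) (assumption | rule that | simp)+
  \<comment> \<open>The factor \<open>s\<close> relates \<open>m\<close>-th powers of values of
    \<open>T\<close>; its \<open>m\<close>-th root relates the values themselves.\<close>
  define k where "k = root m s"
  have k: "0 < k" "k ^ m = s" using s m by (simp_all add: k_def)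
  have ta: "form r1 r2 u = k * form r1 r1 u" "form r2 r2 u = k\<^sup>2 * form r1 r1 u" if u: "u \<in> sphere 0 1" for u
  proof -
    note nn = nonneg[OF products_in_cone(1) u] nonneg[OF products_in_cone(2) u]
      nonneg[OF products_in_cone(3) u]
    have "form r1 r2 u ^ m = (k * form r1 r1 u) ^ m" using s(3)[OF u] k by (simp add: power_mult_distrib)
    then show "form r1 r2 u = k * form r1 r1 u" using nn k m by (simp add: power_eq_iff_eq_base)
    have "form r2 r2 u ^ m = (k\<^sup>2 * form r1 r1 u) ^ m" using s(2)[OF u] k
      by (simp add: power_mult_distrib power_even_eq flip: power_mult)
    then show "form r2 r2 u = k\<^sup>2 * form r1 r1 u" using nn k m by (simp add: power_eq_iff_eq_base)
  qed
  have "T (\<lambda>v. (k * r1 v - r2 v)\<^sup>2 * h v) u = 0" if u: "u \<in> sphere 0 1" for u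
    using square_expand[OF _ u, of k] k ta[OF u] by (simp add: power2_eq_square)
  from inj[OF square_in_cone this]
  have "(k * r1 u - r2 u)\<^sup>2 * h u = 0" if "u \<in> sphere 0 1" for u using that by blast
  then have "r2 u = k * r1 u" if "u \<in> sphere 0 1" for u using h[OF that] that by force
  with k that show ?thesis by blast
qed

lemma integral_equality_if_proportional:
  assumes l: "0 \<le> l" "\<And>u. u \<in> sphere 0 1 \<Longrightarrow> r1 u = l * r2 u"
  shows "(sphere_integral (\<lambda>u. form r1 r2 u ^ m))\<^sup>2 =
    sphere_integral (\<lambda>u. form r1 r1 u ^ m) * sphere_integral (\<lambda>u. form r2 r2 u ^ m)"
proof -
  have c: "(\<lambda>v. d * (r2 v * r2 v * h v)) \<in> sphere_cone" if "0 \<le> d" for d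
    using that by (intro sphere_cone_mult[OF sphere_cone_const] products_in_cone)
  have "form r1 r2 u = l * form r2 r2 u" if u: "u \<in> sphere 0 1" for u
    using cong[OF products_in_cone(3) c[OF l(1)] u] scale[OF products_in_cone(2) u l(1)] l(2)
    by (simp add: ac_simps)
  then have "sphere_integral (\<lambda>u. form r1 r2 u ^ m) = sphere_integral (\<lambda>u. l ^ m * form r2 r2 u ^ m)"
    by (intro sphere_integral_cong) (simp add: power_mult_distrib)
  moreover have "form r1 r1 u = l\<^sup>2 * form r2 r2 u" if u: "u \<in> sphere 0 1" for u
    using cong[OF products_in_cone(1) c[of "l\<^sup>2"] u] scale[OF products_in_cone(2) u, of "l\<^sup>2"] l(2)
    by (simp add: power2_eq_square ac_simps)
  then have "sphere_integral (\<lambda>u. form r1 r1 u ^ m) = sphere_integral (\<lambda>u. (l ^ m)\<^sup>2 * form r2 r2 u ^ m)"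
    by (intro sphere_integral_cong) (simp add: power_mult_distrib mult.commute flip: power_mult)
  ultimately show ?thesis
    unfolding sphere_integral_cmult by (simp add: power_mult_distrib power2_eq_square)
qed

end

end

section \<open>Radial Blaschke Minkowski homomorphisms\<close>

definition body :: "(real ^ 'n \<Rightarrow> real) \<Rightarrow> (real ^ 'n) set" where
  "body f = (THE K. K \<in> star_bodies \<and> (\<forall>u\<in>sphere 0 1. radial K u ^ (CARD('n) - 1) = f u))"

lemma radial_in_cone: "K \<in> star_bodies \<Longrightarrow> radial K \<in> sphere_cone"
  by (auto simp: star_bodies_def intro!: sphere_coneI radial_attained(1))

lemma body_props:
  fixes f :: "real ^ 'n \<Rightarrow> real"
  assumes "2 \<le> CARD('n)" "f \<in> sphere_cone"
  shows "body f \<in> star_bodies"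
    and "\<And>u. u \<in> sphere 0 1 \<Longrightarrow> radial (body f) u ^ (CARD('n) - 1) = f u"
  using theI'[OF ex1_star_body_radial_power[OF sphere_coneD[OF assms(2)], of "CARD('n) - 1"]] assms(1)
  unfolding body_def by auto

lemma body_eqI:
  fixes f :: "real ^ 'n \<Rightarrow> real"
  assumes "2 \<le> CARD('n)" "f \<in> sphere_cone" "K \<in> star_bodies"
    "\<And>u. u \<in> sphere 0 1 \<Longrightarrow> radial K u ^ (CARD('n) - 1) = f u"
  shows "body f = K"
  unfolding body_def
  using ex1_star_body_radial_power[OF sphere_coneD[OF assms(2)], of "CARD('n) - 1"] assms
  by (intro the1_equality) auto

lemma radial_radial_minkowski_sum:
  assumes "K \<in> star_bodies" "L \<in> star_bodies" "u \<in> sphere 0 1"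
  shows "radial (radial_minkowski_sum K L) u = radial K u + radial L u"
  using theI'[OF ex1_star_body_radial[OF sphere_coneD[OF sphere_cone_add[OF
        radial_in_cone[OF assms(1)] radial_in_cone[OF assms(2)]]]]] assms(3)
  unfolding radial_minkowski_sum_def by auto

lemma radial_blaschke_sum_body:
  fixes f g :: "real ^ 'n \<Rightarrow> real"
  assumes n: "2 \<le> CARD('n)" and f: "f \<in> sphere_cone" and g: "g \<in> sphere_cone"
  shows "radial_blaschke_sum (body f) (body g) = body (\<lambda>u. f u + g u)"
  unfolding radial_blaschke_sum_def body_def[of "\<lambda>u. f u + g u"]
  by (intro arg_cong[where f = The] ext conj_cong ball_cong refl)
     (simp only: body_props(2)[OF n f] body_props(2)[OF n g])

lemma radial_rotate:
  fixes A :: "real ^ 'n ^ 'n"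
  assumes "rotation_matrix A"
  shows "radial ((*v) A ` K) u = radial K (transpose A *v u)"
proof -
  have A: "A ** transpose A = mat 1" "transpose A ** A = mat 1"
    using assms by (auto simp: rotation_matrix_def orthogonal_matrix_def)
  have "l *\<^sub>R u \<in> (*v) A ` K \<longleftrightarrow> l *\<^sub>R (transpose A *v u) \<in> K" for l
  proof
    assume "l *\<^sub>R u \<in> (*v) A ` K"
    then obtain y where y: "y \<in> K" "l *\<^sub>R u = A *v y" by auto
    have "l *\<^sub>R (transpose A *v u) = transpose A *v (l *\<^sub>R u)"
      by (simp add: matrix_vector_mult_scaleR)
    also have "\<dots> = y" unfolding y(2) by (simp add: matrix_vector_mul_assoc A del: transpose_matrix_vector)
    finally show "l *\<^sub>R (transpose A *v u) \<in> K" using y by simp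
  next
    assume *: "l *\<^sub>R (transpose A *v u) \<in> K"
    have "A *v (l *\<^sub>R (transpose A *v u)) = l *\<^sub>R u"
      by (simp add: matrix_vector_mult_scaleR matrix_vector_mul_assoc A del: transpose_matrix_vector)
    with * show "l *\<^sub>R u \<in> (*v) A ` K" by (metis imageI)
  qed
  then show ?thesis by (simp add: radial_def)
qed

lemma star_bodies_rotate:
  fixes A :: "real ^ 'n ^ 'n"
  assumes A: "rotation_matrix A" and K: "K \<in> star_bodies"
  shows "(*v) A ` K \<in> star_bodies"
proof -
  have K': "compact K" "0 \<in> K" "\<And>x. x \<in> K \<Longrightarrow> closed_segment 0 x \<subseteq> K"
    using K by (auto simp: star_bodies_def)
  have "compact ((*v) A ` K)"
    using K' by (intro compact_continuous_image linear_continuous_on matrix_vector_mul_bounded_linear)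
  moreover have "0 \<in> (*v) A ` K"
    using K'(2) by (auto intro!: image_eqI[of _ _ 0])
  moreover have "closed_segment 0 x \<subseteq> (*v) A ` K" if "x \<in> (*v) A ` K" for x
  proof -
    from that obtain y where y: "y \<in> K" "x = A *v y" by auto
    have "closed_segment 0 x = (*v) A ` closed_segment 0 y"
      using closed_segment_linear_image[OF matrix_vector_mul_linear, of A 0 y] y by simp
    with K'(3)[OF y(1)] show ?thesis by blast
  qed
  moreover have "continuous_on (sphere 0 1) (radial ((*v) A ` K))"
    unfolding radial_rotate[OF A, abs_def]
    by (intro sphere_coneD(1) sphere_cone_rotate radial_in_cone K rotation_matrix_transpose A)
  ultimately show ?thesis by (simp add: star_bodies_def)
qed

text \<open>Composing a function with \<open>A\<close> moves the body by the inverse rotation, which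
  is the transpose. This converts equivariance of \<open>\<Psi>\<close> on sets into commutation of
  the operator with composition by \<open>A\<close>.\<close>

lemma body_rotate:
  fixes A :: "real ^ 'n ^ 'n"
  assumes n: "2 \<le> CARD('n)" and f: "f \<in> sphere_cone" and A: "rotation_matrix A"
  shows "body (\<lambda>v. f (A *v v)) = (*v) (transpose A) ` body f"
proof (rule body_eqI[OF n sphere_cone_rotate[OF f A]])
  show "(*v) (transpose A) ` body f \<in> star_bodies"
    by (intro star_bodies_rotate rotation_matrix_transpose A body_props[OF n f])
  fix u :: "real ^ 'n" assume "u \<in> sphere 0 1"
  then have "A *v u \<in> sphere 0 1" by (simp add: norm_rotation_matrix[OF A])
  then show "radial ((*v) (transpose A) ` body f) u ^ (CARD('n) - 1) = f (A *v u)"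
    by (simp add: radial_rotate[OF rotation_matrix_transpose[OF A]] body_props(2)[OF n f, unfolded One_nat_def]
        del: transpose_matrix_vector)
qed

lemma sphere_operator_if_hom:
  fixes \<Psi> :: "(real ^ 'n) set \<Rightarrow> (real ^ 'n) set"
  assumes n: "2 \<le> CARD('n)" and hom: "radial_blaschke_minkowski_hom \<Psi>"
  shows "sphere_operator (\<lambda>f. radial (\<Psi> (body f)))"
proof
  have star: "\<Psi> K \<in> star_bodies" if "K \<in> star_bodies" for K
    using hom that by (auto simp: radial_blaschke_minkowski_hom_def)
  note star_body = star[OF body_props(1)[OF n]]
  fix f :: "real ^ 'n \<Rightarrow> real" assume f: "f \<in> sphere_cone"
  show "radial (\<Psi> (body f)) \<in> sphere_cone"
    by (rule radial_in_cone[OF star_body[OF f]])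
  fix u :: "real ^ 'n" assume u: "u \<in> sphere 0 1"
  show "radial (\<Psi> (body (\<lambda>v. f v + g v))) u = radial (\<Psi> (body f)) u + radial (\<Psi> (body g)) u"
    if g: "g \<in> sphere_cone" for g
  proof -
    have "\<Psi> (body (\<lambda>v. f v + g v)) = radial_minkowski_sum (\<Psi> (body f)) (\<Psi> (body g))"
      using hom body_props(1)[OF n f] body_props(1)[OF n g]
      by (simp add: radial_blaschke_minkowski_hom_def flip: radial_blaschke_sum_body[OF n f g])
    then show ?thesis by (simp add: radial_radial_minkowski_sum[OF star_body[OF f] star_body[OF g] u])
  qed
  show "radial (\<Psi> (body (\<lambda>v. f (A *v v)))) u = radial (\<Psi> (body f)) (A *v u)"
    if A: "rotation_matrix A" for A
  proof -
    have "\<Psi> (body (\<lambda>v. f (A *v v))) = (*v) (transpose A) ` \<Psi> (body f)"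
      using hom body_props(1)[OF n f] rotation_matrix_transpose[OF A]
      by (simp add: radial_blaschke_minkowski_hom_def body_rotate[OF n f A] del: transpose_matrix_vector)
    then show ?thesis by (simp add: radial_rotate[OF rotation_matrix_transpose[OF A]] del: transpose_matrix_vector)
  qed
qed

section \<open>Star bodies and dilates in terms of radial functions\<close>

lemma star_body_eqI:
  assumes "K \<in> star_bodies" "L \<in> star_bodies" "\<And>u. u \<in> sphere 0 1 \<Longrightarrow> radial K u = radial L u"
  shows "K = L"
  using ex1_star_body_radial[OF sphere_coneD[OF radial_in_cone[OF assms(2)]]] assms
  unfolding Ex1_def by metis

lemma star_body_eq_0_if_radial_eq_0:
  fixes K :: "(real ^ 'n) set"
  assumes K: "K \<in> star_bodies" and zero: "\<And>u. u \<in> sphere 0 1 \<Longrightarrow> radial K u = 0"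
  shows "K = {0}"
proof -
  have "K \<subseteq> {0}" by (subst star_body_eq[OF K]) (auto simp: zero)
  moreover have "0 \<in> K" using K by (simp add: star_bodies_def)
  ultimately show ?thesis by auto
qed

lemma star_bodies_scale:
  fixes K :: "(real ^ 'n) set"
  assumes K: "K \<in> star_bodies" and l: "0 < l"
  shows "(\<lambda>x. l *\<^sub>R x) ` K \<in> star_bodies"
    and "\<And>u. u \<in> sphere 0 1 \<Longrightarrow> radial ((\<lambda>x. l *\<^sub>R x) ` K) u = l * radial K u"
proof -
  let ?K = "(\<lambda>x. l *\<^sub>R x) ` K"
  have K': "compact K" "0 \<in> K" "\<And>x. x \<in> K \<Longrightarrow> closed_segment 0 x \<subseteq> K"
    using K by (auto simp: star_bodies_def)
  have c: "compact ?K" using K'(1) by (rule compact_scaling)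
  have z: "0 \<in> ?K" using K'(2) by (auto intro!: image_eqI[of _ _ 0])
  show rad: "radial ?K u = l * radial K u" if u: "u \<in> sphere 0 1" for u
  proof (rule antisym)
    obtain y where y: "y \<in> K" "radial ?K u *\<^sub>R u = l *\<^sub>R y"
      using radial_attained(2)[OF c z u] by auto
    then have "(radial ?K u / l) *\<^sub>R u = y" using l
      by (metis divide_inverse mult.commute scaleR_scaleR scaleR_one left_inverse less_irrefl)
    with y radial_attained(3)[OF K'(1,2) u, of "radial ?K u / l"] radial_attained(1)[OF c z u] l
    have "radial ?K u / l \<le> radial K u" by simp
    then show "radial ?K u \<le> l * radial K u" using l by (simp add: field_simps)
    have "l *\<^sub>R (radial K u *\<^sub>R u) \<in> ?K" by (intro imageI radial_attained(2)[OF K'(1,2) u])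
    then show "l * radial K u \<le> radial ?K u"
      using radial_attained(3)[OF c z u, of "l * radial K u"] radial_attained(1)[OF K'(1,2) u] l by simp
  qed
  have "closed_segment 0 x \<subseteq> ?K" if "x \<in> ?K" for x
  proof -
    from that obtain y where y: "y \<in> K" "x = l *\<^sub>R y" by auto
    have "closed_segment 0 x = (\<lambda>x. l *\<^sub>R x) ` closed_segment 0 y"
      using closed_segment_linear_image[OF linear_scaleR, of l 0 y] y by simp
    with K'(3)[OF y(1)] show ?thesis by blast
  qed
  moreover have "continuous_on (sphere 0 1) (\<lambda>u. l * radial K u)"
    by (intro continuous_intros sphere_coneD(1) radial_in_cone K)
  moreover have "continuous_on (sphere 0 1) (radial ?K) \<longleftrightarrow>
      continuous_on (sphere 0 1) (\<lambda>u. l * radial K u)"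
    by (rule continuous_on_cong[OF refl rad])
  ultimately show "?K \<in> star_bodies" using c z by (simp add: star_bodies_def)
qed

lemma dilates_iff_radial:
  fixes K L :: "(real ^ 'n) set"
  assumes "K \<in> star_bodies" "L \<in> star_bodies"
  shows "dilates K L \<longleftrightarrow> (\<exists>l>0. \<forall>u\<in>sphere 0 1. radial K u = l * radial L u)"
proof
  assume "dilates K L"
  then show "\<exists>l>0. \<forall>u\<in>sphere 0 1. radial K u = l * radial L u"
    using star_bodies_scale(2)[OF assms(2)] by (auto simp: dilates_def)
next
  assume "\<exists>l>0. \<forall>u\<in>sphere 0 1. radial K u = l * radial L u"
  then obtain l where l: "0 < l" "\<And>u. u \<in> sphere 0 1 \<Longrightarrow> radial K u = l * radial L u" by blast
  have "K = (\<lambda>x. l *\<^sub>R x) ` L"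
    by (rule star_body_eqI[OF assms(1) star_bodies_scale(1)[OF assms(2) l(1)]])
       (simp add: l(2) star_bodies_scale(2)[OF assms(2) l(1)])
  with l(1) show "dilates K L" by (auto simp: dilates_def)
qed

text \<open>The converse in the equality case is stated for nondegenerate bodies because radial
  functions may vanish. If \<open>L 1 = {0}\<close> and \<open>L 2 \<noteq> {0}\<close>, both sides
  are 0 although the bodies are not dilates. If some \<open>L i\<close> with
  \<open>i \<ge> 3\<close> has zero radial function on an open part of the sphere, then
  \<open>L 1\<close> and \<open>L 2\<close> can be altered there without changing any of the mixed
  bodies.\<close>

theorem theorem1:
  fixes \<Psi> :: "(real ^ 'n) set \<Rightarrow> (real ^ 'n) set" and L :: "nat \<Rightarrow> (real ^ 'n) set"
  assumes "CARD('n) \<ge> 3"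
    and "radial_blaschke_minkowski_hom \<Psi>"
    and "\<not> trivial_hom \<Psi>"
    and "\<forall>i\<in>{1..CARD('n) - 1}. L i \<in> star_bodies"
  shows "(measure lebesgue (mixed \<Psi> L))\<^sup>2
      \<le> measure lebesgue (mixed \<Psi> (L(2 := L 1))) * measure lebesgue (mixed \<Psi> (L(1 := L 2))) \<and>
    (dilates (L 1) (L 2) \<longrightarrow>
      (measure lebesgue (mixed \<Psi> L))\<^sup>2
        = measure lebesgue (mixed \<Psi> (L(2 := L 1))) * measure lebesgue (mixed \<Psi> (L(1 := L 2)))) \<and>
    (L 1 \<noteq> {0} \<and> L 2 \<noteq> {0} \<and>
      (\<forall>i\<in>{3..CARD('n) - 1}. \<forall>u\<in>sphere 0 1. 0 < radial (L i) u) \<longrightarrow>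
      ((measure lebesgue (mixed \<Psi> L))\<^sup>2
        = measure lebesgue (mixed \<Psi> (L(2 := L 1))) * measure lebesgue (mixed \<Psi> (L(1 := L 2)))
       \<longleftrightarrow> dilates (L 1) (L 2)))"
proof -
  let ?n = "CARD('n)"
  have n: "2 \<le> ?n" "0 < ?n" using assms(1) by simp_all
  define h where "h u = (\<Prod>i=3..?n - 1. radial (L i) u)" for u
  define r1 r2 where "r1 = radial (L 1)" and "r2 = radial (L 2)"
  have star: "L i \<in> star_bodies" if "1 \<le> i" "i \<le> ?n - 1" for i using assms(4) that by simp
  have star12: "L 1 \<in> star_bodies" "L 2 \<in> star_bodies" using assms(1) by (auto intro!: star)
  have cone: "r1 \<in> sphere_cone" "r2 \<in> sphere_cone" "h \<in> sphere_cone"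
    unfolding r1_def r2_def h_def using star12
    by (auto intro!: sphere_cone_prod radial_in_cone star)
  interpret sphere_operator "\<lambda>f. radial (\<Psi> (body f))"
    by (rule sphere_operator_if_hom[OF n(1) assms(2)])
  \<comment> \<open>This uses \<open>n \<ge> 3\<close>. For \<open>n = 3\<close> the remaining index
    set is empty and \<open>h\<close> is constantly 1.\<close>
  have "{1..?n - 1} = insert 1 (insert 2 {3..?n - 1})" using assms(1) by auto
  then have prod: "(\<Prod>i=1..?n - 1. radial (M i) u) = 
      radial (M 1) u * radial (M 2) u * (\<Prod>i=3..?n - 1. radial (M i) u)"
    for M :: "nat \<Rightarrow> (real ^ 'n) set" and u by (simp add: mult.assoc)
  have mixed: "measure lebesgue (mixed \<Psi> M) =
      sphere_integral (\<lambda>u. radial (\<Psi> (body (\<lambda>v. radial (M 1) v * radial (M 2) v * h v))) u ^ ?n)"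
    if M: "M 1 \<in> star_bodies" "M 2 \<in> star_bodies" "\<And>i. i \<in> {3..?n - 1} \<Longrightarrow> M i = L i" for M
  proof -
    have "mixed_body M = body (\<lambda>v. radial (M 1) v * radial (M 2) v * h v)"
    proof -
      have "h = (\<lambda>v. \<Prod>i=3..?n - 1. radial (M i) v)"
        unfolding h_def using M(3) by (intro ext prod.cong) simp_all
      then show ?thesis unfolding mixed_body_def body_def prod by simp
    qed
    moreover have "(\<lambda>v. radial (M 1) v * radial (M 2) v * h v) \<in> sphere_cone"
      by (intro sphere_cone_mult radial_in_cone M cone)
    then have "\<Psi> (body (\<lambda>v. radial (M 1) v * radial (M 2) v * h v)) \<in> star_bodies"
      using assms(2) body_props(1)[OF n(1)] by (auto simp: radial_blaschke_minkowski_hom_def)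
    ultimately show ?thesis by (simp add: mixed_def measure_star_body)
  qed
  have V: "measure lebesgue (mixed \<Psi> L) =
      sphere_integral (\<lambda>u. radial (\<Psi> (body (\<lambda>v. r1 v * r2 v * h v))) u ^ ?n)"
    "measure lebesgue (mixed \<Psi> (L(2 := L 1))) =
      sphere_integral (\<lambda>u. radial (\<Psi> (body (\<lambda>v. r1 v * r1 v * h v))) u ^ ?n)"
    "measure lebesgue (mixed \<Psi> (L(1 := L 2))) =
      sphere_integral (\<lambda>u. radial (\<Psi> (body (\<lambda>v. r2 v * r2 v * h v))) u ^ ?n)"
    unfolding r1_def r2_def
    using mixed[of L] mixed[of "L(2 := L 1)"] mixed[of "L(1 := L 2)"] star12 by auto
  note dil = dilates_iff_radial[OF star12, folded r1_def r2_def]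
  show ?thesis unfolding V
  proof (intro conjI impI)
    show eq_if_dilates:
      "(sphere_integral (\<lambda>u. radial (\<Psi> (body (\<lambda>v. r1 v * r2 v * h v))) u ^ ?n))\<^sup>2 =
      sphere_integral (\<lambda>u. radial (\<Psi> (body (\<lambda>v. r1 v * r1 v * h v))) u ^ ?n) *
      sphere_integral (\<lambda>u. radial (\<Psi> (body (\<lambda>v. r2 v * r2 v * h v))) u ^ ?n)"
      if "dilates (L 1) (L 2)"
    proof -
      from that obtain l where "0 < l" "\<And>u. u \<in> sphere 0 1 \<Longrightarrow> r1 u = l * r2 u"
        unfolding dil by blast
      then show ?thesis by (intro integral_equality_if_proportional[OF cone, of l]) simp_all
    qed
    assume pos: "L 1 \<noteq> {0} \<and> L 2 \<noteq> {0} \<and>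
      (\<forall>i\<in>{3..?n - 1}. \<forall>u\<in>sphere 0 1. 0 < radial (L i) u)"
    show "(sphere_integral (\<lambda>u. radial (\<Psi> (body (\<lambda>v. r1 v * r2 v * h v))) u ^ ?n))\<^sup>2 =
      sphere_integral (\<lambda>u. radial (\<Psi> (body (\<lambda>v. r1 v * r1 v * h v))) u ^ ?n) *
      sphere_integral (\<lambda>u. radial (\<Psi> (body (\<lambda>v. r2 v * r2 v * h v))) u ^ ?n) \<longleftrightarrow>
      dilates (L 1) (L 2)" (is "?eq \<longleftrightarrow> _")
    proof
      assume eq: ?eq
      obtain K where K: "K \<in> star_bodies" "\<Psi> K \<noteq> {0}"
        using assms(3) by (auto simp: trivial_hom_def)
      \<comment> \<open>Nontriviality of \<open>\<Psi>\<close> is carried over to the operator: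
        \<open>body f\<close> recovers \<open>K\<close>, so the operator is nonzero at
        \<open>f\<close> in some direction.\<close>
      define f where "f u = radial K u ^ (?n - 1)" for u
      have f: "f \<in> sphere_cone" unfolding f_def by (intro sphere_cone_power radial_in_cone K)
      have "body f = K" using K(1) by (intro body_eqI n f) (simp_all add: f_def)
      then obtain x where x: "x \<in> sphere 0 1" "radial (\<Psi> (body f)) x \<noteq> 0"
        using star_body_eq_0_if_radial_eq_0[of "\<Psi> K"] K assms(2)
        by (auto simp: radial_blaschke_minkowski_hom_def)
      have h: "0 < h u" if "u \<in> sphere 0 1" for u
        unfolding h_def using pos that by (intro prod_pos) blast
      have r: "\<exists>u\<in>sphere 0 1. r1 u \<noteq> 0" "\<exists>u\<in>sphere 0 1. r2 u \<noteq> 0"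
        unfolding r1_def r2_def using star_body_eq_0_if_radial_eq_0 star12 pos by blast+
      obtain k where k: "0 < k" "\<And>u. u \<in> sphere 0 1 \<Longrightarrow> r2 u = k * r1 u"
        by (rule integral_equalityD[OF cone n f x h r eq]) (assumption | rule that | simp)+
      \<comment> \<open>The constant \<open>k\<close> expresses \<open>r2\<close> through
        \<open>r1\<close>, whereas \<open>dilates (L 1) (L 2)\<close> asks for \<open>r1\<close> as
        a multiple of \<open>r2\<close>; hence the inverse.\<close>
      then show "dilates (L 1) (L 2)" unfolding dil
        by (intro exI[of _ "inverse k"]) (simp add: field_simps)
    qed (rule eq_if_dilates)
  qed (rule integral_inequality[OF cone])
qed

end
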